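(* Let $c\in\mathbb{F}$. For any $\mu\in\mathbb{F}$, the $\mathcal{V}ir$-submodule $I_\mu$ of $V_{\mathcal{V}ir}(c,0)$ generated by the vectors $$(L_{-n}^p-\delta_{p\mid n}L_{-np}-\delta_{n,2}\mu^p)\mathbf 1\qquad\text{for }n\ge2$$ is an ideal of the vertex algebra $V_{\mathcal{V}ir}(c,0)$. Furthermore, $I_\mu$ equals the ideal of $V_{\mathcal{V}ir}(c,0)$ generated by $(L_{-2}^p-\mu^p)\mathbf 1$.
   Context: $\mathbb{F}$ is an algebraically closed field of prime characteristic $p\ge 3$; all vector spaces are over $\mathbb{F}$. $\delta_{p\mid n}=1$ if $p\mid n$ and $0$ otherwise. Vertex algebras: a vertex algebra is a vector space $V$ with a linear map $Y(\cdot,x):V\to(\mathrm{End}\,V)[[x,x^{-1}]]$, $v\mapsto Y(v,x)=\sum_{n\in\mathbb{Z}}v_nx^{-n-1}$, and a vector $\mathbf 1\in V$ such that $Y(u,x)v\in V((x))$; $Y(\mathbf 1,x)=\mathrm{id}$; $Y(v,x)\mathbf 1\in V[[x]]$ with constant term $v$; and for $u,v,w\in V$ the Jacobi identity $x_0^{-1}\delta\left(\frac{x_1-x_2}{x_0}\right)Y(u,x_1)Y(v,x_2)w-x_0^{-1}\delta\left(\frac{x_2-x_1}{-x_0}\right)Y(v,x_2)Y(u,x_1)w=x_2^{-1}\delta\left(\frac{x_1-x_0}{x_2}\right)Y(Y(u,x_0)v,x_2)w$ holds, where $\delta(x)=\sum_{n\in\mathbb{Z}}x^n$ and $(x_1\pm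 x_2)^n$ is expanded in nonnegative powers of the second variable. An ideal is a subspace $I$ with $v_nw,\,w_nv\in I$ for all $v\in V$, $w\in I$, $n\in\mathbb{Z}$. Virasoro: $\mathcal{V}ir$ is the Lie algebra with basis $\{L_n\mid n\in\mathbb{Z}\}\cup\{\mathbf c\}$, $\mathbf c$ central, $[L_m,L_n]=(m-n)L_{m+n}+\frac12\binom{m+1}{3}\delta_{m+n,0}\mathbf c$. $V_{\mathcal{V}ir}(c,0)$ is the $\mathcal{V}ir$-module induced from the one-dimensional module of the subalgebra spanned by $\mathbf c$ and $L_n$ ($n\ge-1$), where $\mathbf c$ acts as $c$ and each $L_n$ ($n\ge -1$) acts as $0$; $\mathbf 1=1\otimes1$. It has a unique vertex algebra structure with vacuum $\mathbf 1$ and $Y(\omega,x)=\sum_{n\in\mathbb{Z}}L_nx^{-n-2}$, where $\omega=L_{-2}\mathbf 1$. *)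

theory Defs
  imports
    "HOL-Computational_Algebra.Computational_Algebra"
    "HOL-Library.Poly_Mapping"
    "HOL-Library.Groups_Big_Fun"
    "HOL-Library.Product_Plus"
begin

section \<open>Binomial coefficients of integers\<close>

text \<open>This is the library's \<open>n gchoose k\<close> at type \<open>int\<close>; \<open>Complex_Main\<close> leaves a sort constraint on the
  syntax of \<open>gchoose\<close> that excludes \<open>int\<close> from being used there.\<close>

definition int_binom :: "int \<Rightarrow> nat \<Rightarrow> int" where
  "int_binom n k = (\<Prod>i = 0..<k. n - of_nat i) div fact k"

lemmas int_binom_eq_gbinomial = int_binom_def [folded gbinomial_prod_rev]

lemma int_binom_mult_fact: "int_binom n k * fact k = (\<Prod>i = 0..<k. n - int i)"
  unfolding int_binom_eq_gbinomial by (rule gbinomial_int_mult_fact')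


section \<open>Free vector spaces\<close>

definition pm_scale :: "'a::field \<Rightarrow> ('b \<Rightarrow>\<^sub>0 'a) \<Rightarrow> ('b \<Rightarrow>\<^sub>0 'a)" where
  "pm_scale a x = Poly_Mapping.map ((*) a) x"

lemma lookup_pm_scale: "Poly_Mapping.lookup (pm_scale a x) k = a * Poly_Mapping.lookup x k"
  by (simp add: pm_scale_def Poly_Mapping.map.rep_eq when_def)

lemma vector_space_pm_scale: "vector_space (pm_scale :: 'a::field \<Rightarrow> ('b \<Rightarrow>\<^sub>0 'a) \<Rightarrow> _)"
  by unfold_locales
    (auto intro!: poly_mapping_eqI simp: lookup_pm_scale lookup_add algebra_simps)


section \<open>Modules over a Lie algebra and induced modules\<close>

text \<open>\<open>V\<close> is a module for the Lie subalgebra \<open>B\<close> of a Lie algebra with scalar multiplication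
  \<open>sg\<close> and bracket \<open>br\<close>.\<close>

definition lie_module ::
  "('a::field \<Rightarrow> 'g::ab_group_add \<Rightarrow> 'g) \<Rightarrow> ('g \<Rightarrow> 'g \<Rightarrow> 'g) \<Rightarrow> 'g set \<Rightarrow>
   ('a \<Rightarrow> 'v::ab_group_add \<Rightarrow> 'v) \<Rightarrow> ('g \<Rightarrow> 'v \<Rightarrow> 'v) \<Rightarrow> bool" where
  "lie_module sg br B sv act \<longleftrightarrow>
     vector_space sv \<and>
     (\<forall>x\<in>B. Vector_Spaces.linear sv sv (act x)) \<and>
     (\<forall>x\<in>B. \<forall>y\<in>B. \<forall>v. act (x + y) v = act x v + act y v) \<and>
     (\<forall>a. \<forall>x\<in>B. \<forall>v. act (sg a x) v = sv a (act x v)) \<and>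
     (\<forall>x\<in>B. \<forall>y\<in>B. \<forall>v. act (br x y) v = act x (act y v) - act y (act x v))"

text \<open>The tensor product \<open>U(g) \<otimes>\<^bsub>U(B)\<^esub> W\<close> is the free vector space on the pairs
  \<open>([x\<^sub>1, \<dots>, x\<^sub>k], w)\<close>, which stand for \<open>x\<^sub>1 \<cdots> x\<^sub>k \<otimes> w\<close>, modulo the
  span of the vectors below.  The sets express, in this order: multilinearity of the words
  (so that they span the tensor algebra of \<open>g\<close>), linearity in \<open>w\<close>, the defining relations
  \<open>x y - y x = [x, y]\<close> of \<open>U(g)\<close>, and \<open>u x \<otimes> w = u \<otimes> x w\<close> for \<open>x\<close> in \<open>B\<close>.\<close>

definition induced_relations ::
  "('a::field \<Rightarrow> 'g::ab_group_add \<Rightarrow> 'g) \<Rightarrow> ('g \<Rightarrow> 'g \<Rightarrow> 'g) \<Rightarrow> 'g set \<Rightarrow>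
   ('a \<Rightarrow> 'w::ab_group_add \<Rightarrow> 'w) \<Rightarrow> ('g \<Rightarrow> 'w \<Rightarrow> 'w) \<Rightarrow> (('g list \<times> 'w) \<Rightarrow>\<^sub>0 'a) set" where
  "induced_relations sg br B sw actw =
     {Poly_Mapping.single (u @ [x + y] @ v, w) 1 - Poly_Mapping.single (u @ [x] @ v, w) 1
        - Poly_Mapping.single (u @ [y] @ v, w) 1 | u v x y w. True} \<union>
     {Poly_Mapping.single (u @ [sg a x] @ v, w) 1 - Poly_Mapping.single (u @ [x] @ v, w) a
        | u v a x w. True} \<union>
     {Poly_Mapping.single (u, w + w') 1 - Poly_Mapping.single (u, w) 1
        - Poly_Mapping.single (u, w') 1 | u w w'. True} \<union>
     {Poly_Mapping.single (u, sw a w) 1 - Poly_Mapping.single (u, w) a | u a w. True} \<union>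
     {Poly_Mapping.single (u @ [x, y] @ v, w) 1 - Poly_Mapping.single (u @ [y, x] @ v, w) 1
        - Poly_Mapping.single (u @ [br x y] @ v, w) 1 | u v x y w. True} \<union>
     {Poly_Mapping.single (u @ [x], w) 1 - Poly_Mapping.single (u, actw x w) 1
        | u x w. x \<in> B}"

text \<open>The linear map with \<open>x\<^sub>1 \<cdots> x\<^sub>k \<otimes> w \<mapsto> x\<^sub>1 (\<dots> (x\<^sub>k (\<iota> w)))\<close>.\<close>

definition induced_eval ::
  "('a::field \<Rightarrow> 'v::ab_group_add \<Rightarrow> 'v) \<Rightarrow> ('g \<Rightarrow> 'v \<Rightarrow> 'v) \<Rightarrow> ('w \<Rightarrow> 'v) \<Rightarrow>
   (('g list \<times> 'w) \<Rightarrow>\<^sub>0 'a) \<Rightarrow> 'v" where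
  "induced_eval sv act \<iota> f =
     (\<Sum>k\<in>Poly_Mapping.keys f. sv (Poly_Mapping.lookup f k) (foldr act (fst k) (\<iota> (snd k))))"

text \<open>The \<open>g\<close>-module \<open>V\<close> together with \<open>\<iota> : W \<rightarrow> V\<close> is (isomorphic to) the module induced from
  the \<open>B\<close>-module \<open>W\<close>, with \<open>\<iota> w\<close> corresponding to \<open>1 \<otimes> w\<close>: the map
  \<open>U(g) \<otimes>\<^bsub>U(B)\<^esub> W \<rightarrow> V\<close>, \<open>u \<otimes> w \<mapsto> u (\<iota> w)\<close>, is well defined and bijective.\<close>

definition is_induced_module ::
  "('a::field \<Rightarrow> 'g::ab_group_add \<Rightarrow> 'g) \<Rightarrow> ('g \<Rightarrow> 'g \<Rightarrow> 'g) \<Rightarrow> 'g set \<Rightarrow>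
   ('a \<Rightarrow> 'w::ab_group_add \<Rightarrow> 'w) \<Rightarrow> ('g \<Rightarrow> 'w \<Rightarrow> 'w) \<Rightarrow>
   ('a \<Rightarrow> 'v::ab_group_add \<Rightarrow> 'v) \<Rightarrow> ('g \<Rightarrow> 'v \<Rightarrow> 'v) \<Rightarrow> ('w \<Rightarrow> 'v) \<Rightarrow> bool" where
  "is_induced_module sg br B sw actw sv act \<iota> \<longleftrightarrow>
     lie_module sg br B sw actw \<and>
     lie_module sg br UNIV sv act \<and>
     surj (induced_eval sv act \<iota>) \<and>
     {f. induced_eval sv act \<iota> f = 0} = module.span pm_scale (induced_relations sg br B sw actw)"

definition lie_submodule ::
  "('a::field \<Rightarrow> 'v::ab_group_add \<Rightarrow> 'v) \<Rightarrow> ('g \<Rightarrow> 'v \<Rightarrow> 'v) \<Rightarrow> 'v set \<Rightarrow> bool" where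
  "lie_submodule sv act I \<longleftrightarrow> module.subspace sv I \<and> (\<forall>x. \<forall>v\<in>I. act x v \<in> I)"


section \<open>The Virasoro algebra\<close>

datatype vir_basis = L_basis int | c_basis

type_synonym 'a vir = "vir_basis \<Rightarrow>\<^sub>0 'a"

fun vir_bracket_basis :: "vir_basis \<Rightarrow> vir_basis \<Rightarrow> 'a::field vir" where
  "vir_bracket_basis (L_basis m) (L_basis n) =
     Poly_Mapping.single (L_basis (m + n)) (of_int (m - n)) +
     (if m + n = 0
      then Poly_Mapping.single c_basis (1 / 2 * of_int (int_binom (m + 1) 3)) else 0)"
| "vir_bracket_basis c_basis _ = 0"
| "vir_bracket_basis _ c_basis = 0"

definition vir_bracket :: "'a::field vir \<Rightarrow> 'a vir \<Rightarrow> 'a vir" where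
  "vir_bracket x y =
     (\<Sum>i\<in>Poly_Mapping.keys x. \<Sum>j\<in>Poly_Mapping.keys y.
        pm_scale (Poly_Mapping.lookup x i * Poly_Mapping.lookup y j) (vir_bracket_basis i j))"

definition vir_ge_minus1 :: "'a::field vir set" where
  "vir_ge_minus1 = module.span pm_scale
     (insert (Poly_Mapping.single c_basis 1) {Poly_Mapping.single (L_basis n) 1 | n. n \<ge> -1})"

text \<open>The action on the one-dimensional space \<open>\<bbbF>\<close> for which the central element acts as \<open>c\<close> and
  every \<open>L\<^sub>n\<close> with \<open>n \<ge> -1\<close> acts as \<open>0\<close> (meaningful on \<open>vir_ge_minus1\<close> only).\<close>

definition vir_char_act :: "'a::field \<Rightarrow> 'a vir \<Rightarrow> 'a \<Rightarrow> 'a" where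
  "vir_char_act c x w = c * Poly_Mapping.lookup x c_basis * w"

text \<open>\<open>V\<close> is \<open>V\<^bsub>Vir\<^esub>(c, 0)\<close>, with \<open>one\<close> corresponding to \<open>1 \<otimes> 1\<close>.\<close>

definition is_virasoro_vacuum_module ::
  "'a::field \<Rightarrow> ('a \<Rightarrow> 'v::ab_group_add \<Rightarrow> 'v) \<Rightarrow> ('a vir \<Rightarrow> 'v \<Rightarrow> 'v) \<Rightarrow> 'v \<Rightarrow> bool" where
  "is_virasoro_vacuum_module c scale act one \<longleftrightarrow>
     is_induced_module pm_scale vir_bracket vir_ge_minus1 (*) (vir_char_act c)
       scale act (\<lambda>a. scale a one)"

definition vir_L :: "('a::field vir \<Rightarrow> 'v \<Rightarrow> 'v) \<Rightarrow> int \<Rightarrow> 'v \<Rightarrow> 'v" where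
  "vir_L act n = act (Poly_Mapping.single (L_basis n) 1)"


section \<open>Vertex algebras\<close>

text \<open>A formal distribution in \<open>x\<^sub>0, x\<^sub>1, x\<^sub>2\<close> is the function sending \<open>(i, j, k)\<close> to its coefficient
  of \<open>x\<^sub>0\<^sup>i x\<^sub>1\<^sup>j x\<^sub>2\<^sup>k\<close>.  All products taken below have finitely many non-zero terms in each
  coefficient, because of the truncation axiom.\<close>

type_synonym 'b fdist = "int \<times> int \<times> int \<Rightarrow> 'b"

definition fdist_mult ::
  "('a \<Rightarrow> 'v::ab_group_add \<Rightarrow> 'v) \<Rightarrow> 'a fdist \<Rightarrow> 'v fdist \<Rightarrow> 'v fdist" where
  "fdist_mult scale D F e = Sum_any (\<lambda>d. scale (D d) (F (e - d)))"

text \<open>The coefficient of \<open>x\<^sup>a y\<^sup>b\<close> in \<open>(x - y)\<^sup>n\<close>, expanded in non-negative powers of \<open>y\<close>.\<close>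

definition diff_power_coeff :: "int \<Rightarrow> int \<Rightarrow> int \<Rightarrow> 'a::field" where
  "diff_power_coeff n a b =
     (if b \<ge> 0 \<and> a + b = n then (- 1) ^ nat b * of_int (int_binom n (nat b)) else 0)"

text \<open>\<open>x\<^sub>0\<^sup>-\<^sup>1 \<delta>((x\<^sub>1 - x\<^sub>2) / x\<^sub>0)\<close>, \<open>x\<^sub>0\<^sup>-\<^sup>1 \<delta>((x\<^sub>2 - x\<^sub>1) / (-x\<^sub>0))\<close> and
  \<open>x\<^sub>2\<^sup>-\<^sup>1 \<delta>((x\<^sub>1 - x\<^sub>0) / x\<^sub>2)\<close>; in \<open>\<delta>(z) = \<Sum>\<^sub>n z\<^sup>n\<close> only the summand \<open>n = -i-1\<close>
  (respectively \<open>n = -k-1\<close>) contributes to the coefficient of \<open>x\<^sub>0\<^sup>i x\<^sub>1\<^sup>j x\<^sub>2\<^sup>k\<close>.\<close>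

definition delta_12_0 :: "'a::field fdist" where
  "delta_12_0 = (\<lambda>(i, j, k). diff_power_coeff (- i - 1) j k)"

definition delta_21_0 :: "'a::field fdist" where
  "delta_21_0 = (\<lambda>(i, j, k). (- 1) powi (- i - 1) * diff_power_coeff (- i - 1) k j)"

definition delta_10_2 :: "'a::field fdist" where
  "delta_10_2 = (\<lambda>(i, j, k). diff_power_coeff (- k - 1) j i)"

text \<open>\<open>Y v n\<close> is the mode \<open>v\<^sub>n\<close>, that is, the coefficient of \<open>x\<^sup>-\<^sup>n\<^sup>-\<^sup>1\<close> in \<open>Y(v, x)\<close>.  The three
  distributions in the Jacobi identity are \<open>Y(u, x\<^sub>1) Y(v, x\<^sub>2) w\<close>, \<open>Y(v, x\<^sub>2) Y(u, x\<^sub>1) w\<close> and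
  \<open>Y(Y(u, x\<^sub>0) v, x\<^sub>2) w\<close>.\<close>

locale vertex_algebra = vector_space scale
  for scale :: "'a::field \<Rightarrow> 'v::ab_group_add \<Rightarrow> 'v" +
  fixes Y :: "'v \<Rightarrow> int \<Rightarrow> 'v \<Rightarrow> 'v"
    and one :: 'v
  assumes Y_linear_right: "\<And>v n. Vector_Spaces.linear scale scale (Y v n)"
    and Y_linear_left: "\<And>n w. Vector_Spaces.linear scale scale (\<lambda>v. Y v n w)"
    and truncation: "\<And>u v. \<exists>N. \<forall>n\<ge>N. Y u n v = 0"
    and vacuum: "\<And>n v. Y one n v = (if n = -1 then v else 0)"
    and creation: "\<And>v n. n \<ge> 0 \<Longrightarrow> Y v n one = 0"
    and creation_const: "\<And>v. Y v (-1) one = v"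
    and jacobi: "\<And>u v w e.
      fdist_mult scale delta_12_0
        (\<lambda>(i, j, k). if i = 0 then Y u (- j - 1) (Y v (- k - 1) w) else 0) e -
      fdist_mult scale delta_21_0
        (\<lambda>(i, j, k). if i = 0 then Y v (- k - 1) (Y u (- j - 1) w) else 0) e =
      fdist_mult scale delta_10_2
        (\<lambda>(i, j, k). if j = 0 then Y (Y u (- i - 1) v) (- k - 1) w else 0) e"

definition va_ideal ::
  "('a::field \<Rightarrow> 'v::ab_group_add \<Rightarrow> 'v) \<Rightarrow> ('v \<Rightarrow> int \<Rightarrow> 'v \<Rightarrow> 'v) \<Rightarrow> 'v set \<Rightarrow> bool" where
  "va_ideal scale Y I \<longleftrightarrow>
     module.subspace scale I \<and> (\<forall>v. \<forall>w\<in>I. \<forall>n. Y v n w \<in> I \<and> Y w n v \<in> I)"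


section \<open>The submodule \<open>I\<^sub>\<mu>\<close>\<close>

definition I_mu ::
  "('a::field \<Rightarrow> 'v::ab_group_add \<Rightarrow> 'v) \<Rightarrow> ('a vir \<Rightarrow> 'v \<Rightarrow> 'v) \<Rightarrow> 'v \<Rightarrow> nat \<Rightarrow> 'a \<Rightarrow> 'v set" where
  "I_mu scale act one p \<mu> = lie_submodule scale act hull
     {(vir_L act (- int n) ^^ p) one
        - (if p dvd n then vir_L act (- int (n * p)) one else 0)
        - (if n = 2 then scale (\<mu> ^ p) one else 0) | n. n \<ge> 2}"

end

theory Submission
  imports Defs "HOL-Number_Theory.Cong"
begin

text \<open>
  In characteristic \<open>p\<close> the operators \<open>P\<^sub>n = L\<^sub>-\<^sub>n\<^sup>p - \<delta>\<^bsub>p|n\<^esub> L\<^bsub>-np\<^esub>\<close> commute with the Virasoro algebra, because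
  \<open>(ad x)\<^sup>p = ad (x\<^sup>p)\<close>.  Hence the modes of \<open>P\<^sub>n 1\<close> commute with the Virasoro algebra as well, and
  they are determined by their values on the vacuum, which are the divided power translates
  \<open>D\<^bsup>(k)\<^esup> P\<^sub>n 1\<close>.  Conjugation by \<open>e\<^bsup>zD\<^esup>\<close> turns \<open>L\<^sub>-\<^sub>n\<close> into a series \<open>\<Sum>\<^sub>j b\<^sub>j z\<^sup>j L\<^bsub>-n-j\<^esub>\<close>, and by Jacobson's formula
  the \<open>p\<close>-th power of a sum is the sum of the \<open>p\<close>-th powers up to a Lie polynomial, here a linear
  combination of modes \<open>L\<^sub>-\<^sub>N\<close>, \<open>N \<ge> 2\<close>.  So \<open>D\<^bsup>(k)\<^esup> P\<^sub>n 1\<close> differs from \<open>b\<^sub>j\<^sup>p P\<^bsub>n+j\<^esub> 1\<close> (if \<open>k = pj\<close>) or from \<open>0\<close>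
  (if \<open>p\<close> does not divide \<open>k\<close>) by a vector \<open>\<Sum> s\<^sub>N L\<^sub>-\<^sub>N 1\<close> that is killed by all \<open>L\<^sub>m\<close>, \<open>m \<ge> -1\<close>, and such a
  vector is zero.  This gives closure under right modes, and, as \<open>b\<^sub>j = 1\<close> for \<open>n = 2\<close>, it produces
  every generator from the one with \<open>n = 2\<close>.
\<close>

section \<open>Jacobson's formula\<close>

definition commutator :: "'r::ring \<Rightarrow> 'r \<Rightarrow> 'r" where
  "commutator x y = x * y - y * x"

text \<open>Left and right multiplication by \<open>x\<close> commute, so this is the binomial
  theorem for their difference.\<close>

lemma funpow_commutator:
  fixes x y :: "'r::ring_1"
  shows "(commutator x ^^ m) y =
    (\<Sum>i\<le>m. of_int ((- 1) ^ i * int (m choose i)) * (x ^ (m - i) * y * x ^ i))"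
proof (induction m)
  case (Suc m)
  define b where "b = (\<lambda>m i. of_int ((- 1) ^ i * int (m choose i)) :: 'r)"
  define Z where "Z = (\<lambda>i. x ^ (Suc m - i) * y * x ^ i)"
  have IH: "(commutator x ^^ m) y = (\<Sum>i\<le>m. b m i * (x ^ (m - i) * y * x ^ i))"
    unfolding b_def by (rule Suc.IH)
  have b0: "b k 0 = 1" and b_Suc: "b (Suc k) (Suc i) = b k (Suc i) - b k i" for k i
    by (simp_all add: b_def algebra_simps)
  have b_comm: "w * (b k i * z) = b k i * (w * z)" for k i w z
    unfolding b_def by (subst (1 2) mult.assoc [symmetric]) (simp only: mult_of_int_commute)
  have left: "x * (b m i * (x ^ (m - i) * y * x ^ i)) = b m i * Z i" if "i \<le> m" for i
    using that by (simp add: b_comm Z_def Suc_diff_le mult.assoc)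
  have right: "b m i * (x ^ (m - i) * y * x ^ i) * x = b m i * Z (Suc i)" for i
    by (simp add: Z_def mult.assoc power_Suc2 del: power_Suc)
  have "(commutator x ^^ Suc m) y = (\<Sum>i\<le>m. b m i * Z i) - (\<Sum>i\<le>m. b m i * Z (Suc i))"
    using left right
    by (simp add: IH commutator_def [of x "sum _ _"]
        sum_distrib_left sum_distrib_right del: of_int_mult)
  also have "(\<Sum>i\<le>m. b m i * Z i) = (\<Sum>i\<le>Suc m. b m i * Z i)"
    by (simp add: b_def binomial_eq_0)
  also have "\<dots> = Z 0 + (\<Sum>i\<le>m. b m (Suc i) * Z (Suc i))"
    by (simp only: sum.atMost_Suc_shift b0 mult_1)
  also have "\<dots> - (\<Sum>i\<le>m. b m i * Z (Suc i)) = Z 0 + (\<Sum>i\<le>m. b (Suc m) (Suc i) * Z (Suc i))"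
    by (simp add: b_Suc left_diff_distrib sum_subtractf)
  also have "\<dots> = (\<Sum>i\<le>Suc m. b (Suc m) i * Z i)"
    by (simp only: sum.atMost_Suc_shift b0 mult_1)
  finally show ?case
    by (simp add: b_def Z_def)
qed simp

lemma of_int_eq_0_if_dvd:
  assumes "of_nat p = (0 :: 'r::ring_1)" "int p dvd n"
  shows "of_int n = (0 :: 'r)"
  using assms by (metis dvdE mult_zero_left of_int_mult of_int_of_nat_eq)

text \<open>By Pascal's rule neighbouring entries of row \<open>p - 1\<close> add up to an entry of
  row \<open>p\<close> that is divisible by \<open>p\<close>, so in characteristic \<open>p\<close>
  the row alternates between 1 and -1.\<close>

lemma of_int_choose_prime_minus_1:
  assumes "prime p" "of_nat p = (0 :: 'r::ring_1)" "k < p"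
  shows "of_int ((- 1) ^ k * int ((p - 1) choose k)) = (1 :: 'r)"
  using \<open>k < p\<close>
proof (induction k)
  case (Suc k)
  have "p choose Suc k = ((p - 1) choose k) + ((p - 1) choose Suc k)"
    using Suc.prems by (cases p) auto
  moreover have "p dvd p choose Suc k"
    using assms(1) Suc.prems by (intro dvd_choose_prime) auto
  ultimately have "of_int ((- 1) ^ k * int (((p - 1) choose k) + ((p - 1) choose Suc k))) = (0::'r)"
    by (intro of_int_eq_0_if_dvd [OF assms(2)]) (metis dvd_mult int_dvd_int_iff)
  then show ?case
    using Suc add.inverse_unique [of 1 "(- 1) ^ k * of_nat (p - Suc 0 choose Suc k) :: 'r"]
    by (simp add: algebra_simps)
qed simp

text \<open>Modulo \<open>p\<close> only the two outer binomial terms survive; oddness of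
  \<open>p\<close> gives the last one its minus sign.\<close>

lemma funpow_commutator_prime:
  fixes x y :: "'r::ring_1"
  assumes "prime p" "of_nat p = (0 :: 'r)" "odd p"
  shows "(commutator x ^^ p) y = commutator (x ^ p) y"
proof -
  let ?t = "\<lambda>i. of_int ((- 1) ^ i * int (p choose i)) * (x ^ (p - i) * y * x ^ i)"
  have "(commutator x ^^ p) y = (\<Sum>i\<in>{0, p}. ?t i)"
    unfolding funpow_commutator
  proof (rule sum.mono_neutral_right)
    show "\<forall>i\<in>{..p} - {0, p}. ?t i = 0"
    proof
      fix i assume "i \<in> {..p} - {0, p}"
      then have "p dvd p choose i"
        using assms(1) by (intro dvd_choose_prime) auto
      then have "of_int ((- 1) ^ i * int (p choose i)) = (0::'r)"
        by (intro of_int_eq_0_if_dvd [OF assms(2)]) auto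
      then show "?t i = 0" by simp
    qed
  qed auto
  also have "\<dots> = commutator (x ^ p) y"
    using assms(3) by (auto simp: commutator_def odd_pos)
  finally show ?thesis .
qed

text \<open>All signed binomial coefficients become 1. The sum has the shape of the derivative of a
  \<open>p\<close>-th power in a noncommutative ring, which is how Lie elements enter.\<close>

lemma funpow_commutator_prime_minus_1:
  fixes x y :: "'r::ring_1"
  assumes "prime p" "of_nat p = (0 :: 'r)"
  shows "(commutator x ^^ (p - 1)) y = (\<Sum>i<p. x ^ i * y * x ^ (p - Suc i))"
proof -
  have p: "p = Suc (p - 1)"
    using assms(1) prime_gt_0_nat by (metis Suc_diff_1)
  have "(commutator x ^^ (p - 1)) y = (\<Sum>i\<le>p - 1. x ^ (p - 1 - i) * y * x ^ i)"
    unfolding funpow_commutator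
    by (rule sum.cong) (use of_int_choose_prime_minus_1 [OF assms] p in \<open>auto simp: less_Suc_eq_le\<close>)
  also have "{..p - 1} = {..<p}"
    by (subst (2) p) (simp only: lessThan_Suc_atMost)
  also have "(\<Sum>i<p. x ^ (p - 1 - i) * y * x ^ i) = (\<Sum>i<p. x ^ i * y * x ^ (p - Suc i))"
    by (subst sum.nat_diff_reindex [symmetric]) (auto intro!: sum.cong)
  finally show ?thesis .
qed

lemma fps_deriv_power_noncommutative:
  fixes f :: "'r::ring_1 fps"
  shows "fps_deriv (f ^ m) = (\<Sum>i<m. f ^ i * fps_deriv f * f ^ (m - Suc i))"
proof (induction m)
  case (Suc m)
  have "fps_deriv (f ^ Suc m) = f ^ m * fps_deriv f + fps_deriv (f ^ m) * f"
    by (simp only: power_Suc2 fps_deriv_mult)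
  also have "fps_deriv (f ^ m) * f = (\<Sum>i<m. f ^ i * fps_deriv f * f ^ (Suc m - Suc i))"
    unfolding Suc.IH sum_distrib_right
    by (rule sum.cong) (auto simp: mult.assoc simp flip: power_Suc2 simp: Suc_diff_Suc)
  finally show ?case by simp
qed simp

section \<open>Lie subrings and \<open>p\<close>-th powers of sums\<close>

locale lie_subring =
  fixes S :: "'r::ring_1 set"
  assumes zero: "0 \<in> S"
    and add: "x \<in> S \<Longrightarrow> y \<in> S \<Longrightarrow> x + y \<in> S"
    and uminus: "x \<in> S \<Longrightarrow> - x \<in> S"
    and commutator: "x \<in> S \<Longrightarrow> y \<in> S \<Longrightarrow> commutator x y \<in> S"
begin

lemma sum: "(\<And>i. i \<in> I \<Longrightarrow> f i \<in> S) \<Longrightarrow> sum f I \<in> S"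
  by (induction I rule: infinite_finite_induct) (auto intro: zero add)

lemma of_nat_mult_mem: "x \<in> S \<Longrightarrow> of_nat n * x \<in> S"
  by (induction n) (auto simp: distrib_right intro: zero add)

lemma of_int_mult_mem: "x \<in> S \<Longrightarrow> of_int n * x \<in> S"
  by (cases n rule: int_cases2) (auto intro: uminus of_nat_mult_mem)

text \<open>The variable is central: after reversing the second convolution, \<open>f $ i\<close>
  meets \<open>g $ (n - i)\<close> in both orders, so each coefficient of a commutator is a sum of
  commutators.\<close>

lemma fps: "lie_subring {f. \<forall>n. f $ n \<in> S}"
proof
  fix f g assume fg: "f \<in> {f. \<forall>n. f $ n \<in> S}" "g \<in> {f. \<forall>n. f $ n \<in> S}"
  have "commutator f g $ n = (\<Sum>i=0..n. commutator (f $ i) (g $ (n - i)))" for n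
  proof -
    have "(\<Sum>i=0..n. g $ i * f $ (n - i)) = (\<Sum>i=0..n. g $ (n - i) * f $ i)"
      by (subst sum.atLeastAtMost_rev) (auto intro!: sum.cong)
    then show ?thesis
      by (simp add: commutator_def fps_mult_nth sum_subtractf)
  qed
  with fg show "commutator f g \<in> {f. \<forall>n. f $ n \<in> S}"
    by (auto intro!: sum commutator)
qed (auto intro: zero add uminus)

end

text \<open>The series is a polynomial in a central variable, so its value at 1, the sum of its
  coefficients, is multiplicative. The induction needs the vanishing above \<open>m\<close> to
  extend the sum by one index.\<close>

lemma sum_nth_linear_fps_power:
  fixes x y :: "'r::ring_1"
  shows "(\<Sum>n\<le>m. ((fps_const y + fps_const x * fps_X) ^ m) $ n) = (x + y) ^ m
     \<and> ((fps_const y + fps_const x * fps_X) ^ m) $ m = x ^ m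
     \<and> (\<forall>n>m. ((fps_const y + fps_const x * fps_X) ^ m) $ n = 0)"
proof (induction m)
  case (Suc m)
  let ?f = "fps_const y + fps_const x * fps_X"
  have nth: "(?f ^ Suc m) $ n = y * (?f ^ m) $ n + (if n = 0 then 0 else x * (?f ^ m) $ (n - 1))" for n
    by (simp add: distrib_right mult.assoc)
  have "(\<Sum>n\<le>Suc m. (?f ^ Suc m) $ n) =
      (\<Sum>n\<le>Suc m. y * (?f ^ m) $ n) + (\<Sum>n\<le>Suc m. if n = 0 then 0 else x * (?f ^ m) $ (n - 1))"
    by (simp only: nth sum.distrib)
  also have "(\<Sum>n\<le>Suc m. y * (?f ^ m) $ n) = y * (x + y) ^ m"
    using Suc.IH by (simp flip: sum_distrib_left)
  also have "(\<Sum>n\<le>Suc m. if n = 0 then 0 else x * (?f ^ m) $ (n - 1)) = x * (x + y) ^ m"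
    using Suc.IH by (subst sum.atMost_Suc_shift) (simp flip: sum_distrib_left)
  finally have 1: "(\<Sum>n\<le>Suc m. (?f ^ Suc m) $ n) = (x + y) ^ Suc m"
    by (simp add: algebra_simps)
  have 2: "(?f ^ Suc m) $ Suc m = x ^ Suc m"
    unfolding nth using Suc.IH by simp
  have 3: "\<forall>n>Suc m. (?f ^ Suc m) $ n = 0"
    unfolding nth using Suc.IH by simp
  from 1 2 3 show ?case by blast
qed auto

context lie_subring
begin

text \<open>The derivative of \<open>(y + x X)^p\<close> in \<open>X\<close> is the
  \<open>(p - 1)\<close>-fold commutator of \<open>y + x X\<close> with \<open>x\<close>, so its
  coefficients are Lie elements. Dividing by the index and setting \<open>X = 1\<close> gives the
  claim; the outer coefficients are \<open>y ^ p\<close> and \<open>x ^ p\<close>.\<close>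

theorem jacobson:
  assumes p: "prime p" "of_nat p = (0 :: 'r)" and xy: "x \<in> S" "y \<in> S"
  shows "(x + y) ^ p - x ^ p - y ^ p \<in> S"
proof -
  let ?f = "fps_const y + fps_const x * fps_X"
  interpret F: lie_subring "{f. \<forall>n. f $ n \<in> S}" by (rule fps)
  have p_fps: "of_nat p = (0 :: 'r fps)"
    using p(2) by (simp flip: fps_of_nat)
  have deriv: "fps_deriv ?f = fps_const x"
    by (simp only: fps_deriv_add fps_deriv_const fps_deriv_mult_const_left fps_deriv_fps_X) simp
  have f: "?f \<in> {f. \<forall>n. f $ n \<in> S}"
    using xy zero by (auto simp: fps_X_def)
  have "(commutator ?f ^^ k) (fps_const x) \<in> {f. \<forall>n. f $ n \<in> S}" for k
    by (induction k) (use xy zero f F.commutator in \<open>auto\<close>)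
  then have "fps_deriv (?f ^ p) \<in> {f. \<forall>n. f $ n \<in> S}"
    by (simp only: fps_deriv_power_noncommutative deriv flip: funpow_commutator_prime_minus_1 [OF p(1) p_fps])
  then have Suc: "of_nat (Suc n) * (?f ^ p) $ Suc n \<in> S" for n
    by (auto dest: spec [of _ n])
  have mid: "(?f ^ p) $ n \<in> S" if n: "0 < n" "n < p" for n
  proof -
    have "\<not> p dvd n" using n by (auto dest: dvd_imp_le)
    then have "coprime (int n) (int p)"
      using p(1) by (metis coprime_commute coprime_int_iff prime_imp_coprime)
    \<comment> \<open>\<open>k\<close> inverts \<open>n\<close> modulo \<open>p\<close>. Being an
      integer it preserves \<open>S\<close>, so the factor \<open>n\<close> produced by
      differentiation cancels inside \<open>S\<close>.\<close>
    then obtain k where "[int n * k = 1] (mod int p)"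
      using cong_solve_coprime_int by blast
    then have "int p dvd int n * k - 1"
      by (simp add: cong_iff_dvd_diff)
    then have "of_int (k * int n) = (1::'r)"
      using of_int_eq_0_if_dvd [OF p(2)] by (metis diff_eq_diff_eq diff_self eq_iff_diff_eq_0 of_int_1 of_int_diff mult.commute)
    moreover have "of_int k * (of_nat n * (?f ^ p) $ n) = of_int (k * int n) * (?f ^ p) $ n"
      by (simp only: of_int_mult of_int_of_nat_eq mult.assoc)
    moreover have "of_int k * (of_nat n * (?f ^ p) $ n) \<in> S"
      using Suc [of "n - 1"] n by (intro of_int_mult_mem) simp
    ultimately show ?thesis by simp
  qed
  have nth0: "(?f ^ p) $ 0 = y ^ p"
    by (simp add: fps_nth_power_0)
  have nthp: "(?f ^ p) $ p = x ^ p"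
    using sum_nth_linear_fps_power [of y x p] by auto
  have "(x + y) ^ p = (\<Sum>n\<le>p. (?f ^ p) $ n)"
    using sum_nth_linear_fps_power [of y x p] by auto
  also have "{..p} = insert 0 (insert p {0<..<p})"
    using p(1) prime_gt_0_nat by auto
  also have "(\<Sum>n\<in>\<dots>. (?f ^ p) $ n) = y ^ p + (x ^ p + (\<Sum>n\<in>{0<..<p}. (?f ^ p) $ n))"
    using p(1) by (simp add: nth0 nthp)
  finally have "(x + y) ^ p - x ^ p - y ^ p = (\<Sum>n\<in>{0<..<p}. (?f ^ p) $ n)"
    by simp
  also have "\<dots> \<in> S"
    by (rule sum) (use mid in auto)
  finally show ?thesis .
qed

lemma jacobson_sum:
  assumes p: "prime p" "of_nat p = (0 :: 'r)" and "finite J" and "\<And>j. j \<in> J \<Longrightarrow> x j \<in> S"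
  shows "(\<Sum>j\<in>J. x j) ^ p - (\<Sum>j\<in>J. x j ^ p) \<in> S"
  using assms(3,4)
proof (induction J)
  case empty
  then show ?case using p(1) zero by (simp add: power_0_left)
next
  case (insert a J)
  then have "(x a + sum x J) ^ p - x a ^ p - sum x J ^ p \<in> S"
    by (intro jacobson p sum) auto
  then have "((x a + sum x J) ^ p - x a ^ p - sum x J ^ p) + (sum x J ^ p - (\<Sum>j\<in>J. x j ^ p)) \<in> S"
    using insert by (intro add) auto
  then show ?case using insert by (simp add: algebra_simps)
qed

text \<open>Coefficients beyond \<open>k\<close> cannot influence coefficient \<open>k\<close>, so
  the finite formula applies to the monomials of degree at most \<open>k\<close>. Their
  \<open>p\<close>-th powers sit in degrees \<open>j * p\<close>, which leaves one term if
  \<open>p\<close> divides \<open>k\<close> and none otherwise.\<close>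

lemma jacobson_fps:
  assumes p: "prime p" "of_nat p = (0 :: 'r)" and A: "\<And>j. A $ j \<in> S"
  shows "(A ^ p) $ k - (if p dvd k then (A $ (k div p)) ^ p else 0) \<in> S"
proof -
  interpret F: lie_subring "{f. \<forall>n. f $ n \<in> S}" by (rule fps)
  define x where "x = (\<lambda>j. fps_const (A $ j) * fps_X ^ j)"
  have p_fps: "of_nat p = (0 :: 'r fps)"
    using p(2) by (simp flip: fps_of_nat)
  have x_nth: "x j $ n = (if n = j then A $ j else 0)" for j n
    by (simp add: x_def fps_X_power_nth)
  have x_power: "x j ^ m = fps_const ((A $ j) ^ m) * fps_X ^ (j * m)" for j m
  proof (induction m)
    case (Suc m)
    have "x j ^ Suc m = fps_const (A $ j) * (fps_X ^ j * fps_const ((A $ j) ^ m)) * fps_X ^ (j * m)"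
      by (simp add: Suc.IH) (simp add: x_def mult.assoc)
    also have "fps_X ^ j * fps_const ((A $ j) ^ m) = fps_const ((A $ j) ^ m) * fps_X ^ j"
      by (rule fps_mult_fps_X_power_commute)
    finally show ?case
      by (simp add: mult.assoc power_add fps_const_mult [symmetric] del: fps_const_mult)
  qed simp
  have trunc: "(\<Sum>j\<le>k. x j) $ n = A $ n" if "n \<le> k" for n
    using that by (simp add: fps_sum_nth x_nth)
  have pow: "((\<Sum>j\<le>k. x j) ^ m) $ n = (A ^ m) $ n" if "n \<le> k" for m n
    using that
  proof (induction m arbitrary: n)
    case (Suc m)
    then show ?case by (simp add: fps_mult_nth trunc)
  qed simp
  have "(\<Sum>j\<le>k. x j) ^ p - (\<Sum>j\<le>k. x j ^ p) \<in> {f. \<forall>n. f $ n \<in> S}"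
    by (rule F.jacobson_sum [OF p(1) p_fps]) (auto simp: x_nth A zero)
  then have "((\<Sum>j\<le>k. x j) ^ p) $ k - (\<Sum>j\<le>k. (x j ^ p) $ k) \<in> S"
    by (auto simp: fps_sum_nth dest: spec [of _ k])
  moreover have "(\<Sum>j\<le>k. (x j ^ p) $ k) = (if p dvd k then (A $ (k div p)) ^ p else 0)"
  proof -
    have "(x j ^ p) $ k = (if j = k div p then if p dvd k then (A $ (k div p)) ^ p else 0 else 0)" for j
      using p(1) prime_gt_0_nat [of p] by (auto simp: x_power fps_X_power_nth)
    then show ?thesis by simp
  qed
  ultimately show ?thesis
    by (simp add: pow)
qed

end

section \<open>The ring of additive endomorphisms\<close>

text \<open>The class \<open>ring_1\<close> demands \<open>0 \<noteq> 1\<close>, which for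
  endomorphisms says that the group is nonzero.\<close>

class nontrivial_ab_group_add = ab_group_add +
  assumes exists_nonzero: "\<exists>x. x \<noteq> 0"

instance prod :: (ab_group_add, "{ab_group_add, zero_neq_one}") nontrivial_ab_group_add
  by standard (metis snd_conv zero_neq_one zero_prod_def)

typedef (overloaded) 'g additive_endo = "{f :: 'g::ab_group_add \<Rightarrow> 'g. \<forall>x y. f (x + y) = f x + f y}"
  morphisms app_endo Abs_endo
  by (rule exI [of _ id]) simp

lemma app_endo_add_right: "app_endo f (x + y) = app_endo f x + app_endo f y"
  using app_endo [of f] by simp

lemma app_Abs_endo: "(\<And>x y. f (x + y) = f x + f y) \<Longrightarrow> app_endo (Abs_endo f) = f"
  by (rule Abs_endo_inverse) simp

lemma additive_endo_eqI: "(\<And>x. app_endo f x = app_endo g x) \<Longrightarrow> f = g"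
  by (metis app_endo_inject ext)

instantiation additive_endo :: (ab_group_add) ring
begin

definition "0 = Abs_endo (\<lambda>x. 0)"
definition "f + g = Abs_endo (\<lambda>x. app_endo f x + app_endo g x)"
definition "- f = Abs_endo (\<lambda>x. - app_endo f x)"
definition "f - g = Abs_endo (\<lambda>x. app_endo f x - app_endo g x)"
definition "f * g = Abs_endo (\<lambda>x. app_endo f (app_endo g x))"

lemma app_endo_simps:
  "app_endo 0 x = 0" "app_endo (f + g) x = app_endo f x + app_endo g x"
  "app_endo (- f) x = - app_endo f x" "app_endo (f - g) x = app_endo f x - app_endo g x"
  "app_endo (f * g) x = app_endo f (app_endo g x)"
  by (simp_all add: zero_additive_endo_def plus_additive_endo_def uminus_additive_endo_def
      minus_additive_endo_def times_additive_endo_def app_Abs_endo app_endo_add_right algebra_simps)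

instance
  by standard (auto intro!: additive_endo_eqI simp: app_endo_simps app_endo_add_right algebra_simps)

end

instantiation additive_endo :: (nontrivial_ab_group_add) ring_1
begin

definition "1 = Abs_endo (\<lambda>x. x)"

lemma app_endo_one: "app_endo 1 x = x"
  by (simp add: one_additive_endo_def app_Abs_endo)

instance
proof
  obtain x :: 'a where "x \<noteq> 0" using exists_nonzero by blast
  then have "app_endo 0 x \<noteq> app_endo 1 x"
    by (simp add: app_endo_simps app_endo_one)
  then show "(0 :: 'a additive_endo) \<noteq> 1"
    by auto
qed (auto intro!: additive_endo_eqI simp: app_endo_simps app_endo_one)

end

text \<open>The extra field component makes the ring of endomorphisms non-trivial even if \<open>V = 0\<close>.\<close>

definition endo_lift :: "('v \<Rightarrow> 'v) \<Rightarrow> ('v::ab_group_add \<times> 'a::field) additive_endo" where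
  "endo_lift f = Abs_endo (\<lambda>x. (f (fst x), 0))"

text \<open>A lift annihilates the field component, so the lift of the identity is not 1; evaluation
  at \<open>(v, 0)\<close> hides the difference.\<close>

definition endo_apply :: "('v::ab_group_add \<times> 'a::field) additive_endo \<Rightarrow> 'v \<Rightarrow> 'v" where
  "endo_apply F v = fst (app_endo F (v, 0))"

lemma app_endo_lift:
  assumes "Modules.additive f"
  shows "app_endo (endo_lift f) x = (f (fst x), 0)"
  using assms by (simp add: endo_lift_def app_Abs_endo additive.add)

lemma endo_apply_lift: "Modules.additive f \<Longrightarrow> endo_apply (endo_lift f) v = f v"
  by (simp add: endo_apply_def app_endo_lift)

lemma endo_apply_lift_mult:
  "Modules.additive f \<Longrightarrow> endo_apply (endo_lift f * F) v = f (endo_apply F v)"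
  by (simp add: endo_apply_def app_endo_simps app_endo_lift)

lemma endo_apply_simps:
  "endo_apply 0 v = 0" "endo_apply 1 v = v"
  "endo_apply (F + G) v = endo_apply F v + endo_apply G v"
  "endo_apply (F - G) v = endo_apply F v - endo_apply G v"
  by (simp_all add: endo_apply_def app_endo_simps app_endo_one)

lemma endo_apply_sum: "endo_apply (sum F I) v = (\<Sum>i\<in>I. endo_apply (F i) v)"
  by (induction I rule: infinite_finite_induct) (simp_all add: endo_apply_simps)

lemma endo_lift_power:
  assumes "Modules.additive f"
  shows "endo_apply (endo_lift f ^ m) v = (f ^^ m) v"
  by (induction m) (simp_all add: endo_apply_simps endo_apply_lift_mult assms)

section \<open>Consequences of the Jacobi identity\<close>

lemma fdist_mult_eq_sum:
  fixes K :: nat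
  assumes "inj_on h {..<K}"
    and "\<And>d. d \<notin> h ` {..<K} \<Longrightarrow> scale (D d) (F (e - d)) = 0"
  shows "fdist_mult scale D F e = (\<Sum>b<K. scale (D (h b)) (F (e - h b)))"
proof -
  have "fdist_mult scale D F e = (\<Sum>d\<in>h ` {..<K}. scale (D d) (F (e - d)))"
    unfolding fdist_mult_def by (rule Sum_any.expand_superset) (rule finite_imageI finite_lessThan | use assms(2) in blast)+
  also have "\<dots> = (\<Sum>b<K. scale (D (h b)) (F (e - h b)))"
    by (rule sum.reindex_cong [OF assms(1)]) auto
  finally show ?thesis .
qed

lemma int_binom_0: "int_binom n 0 = 1"
  by (simp add: int_binom_def)

lemma int_binom_eq_0: "0 \<le> n \<Longrightarrow> n < int k \<Longrightarrow> int_binom n k = 0"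
proof -
  assume n: "0 \<le> n" "n < int k"
  then have "(\<Prod>i = 0..<k. n - int i) = 0"
    by (intro prod_zero) (auto intro: bexI [of _ "nat n"])
  then show ?thesis by (simp only: int_binom_def div_0)
qed

text \<open>Together with the sign, every coefficient of \<open>(x - y)^(-1)\<close> becomes 1. This
  is why, for \<open>n = 2\<close>, translates of one generator yield all others.\<close>

lemma int_binom_minus_1: "int_binom (- 1) k = (- 1) ^ k"
proof -
  have "(\<Prod>i = 0..<k. - 1 - int i) = (- 1) ^ k * fact k"
    by (induction k) (simp_all add: algebra_simps)
  then show ?thesis by (simp add: int_binom_def)
qed

context vertex_algebra
begin

text \<open>The coefficient of \<open>x^(l - b) y^b\<close> in \<open>(x - y)^l\<close>.\<close>

definition binom_sign :: "int \<Rightarrow> nat \<Rightarrow> 'a" where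
  "binom_sign l b = (- 1) ^ b * of_int (int_binom l b)"

lemma module_hom_Y_left: "module_hom scale scale (\<lambda>v. Y v n w)"
  using Y_linear_left by (simp add: linear_iff_module_hom)

lemma module_hom_Y: "module_hom scale scale (Y v n)"
  using Y_linear_right by (simp add: linear_iff_module_hom)

lemmas Y_left_add = module_hom.add [OF module_hom_Y_left]
  and Y_left_diff = module_hom.diff [OF module_hom_Y_left]
  and Y_left_scale = module_hom.scale [OF module_hom_Y_left]
  and Y_left_zero = module_hom.zero [OF module_hom_Y_left]
  and Y_add = module_hom.add [OF module_hom_Y]
  and Y_scale = module_hom.scale [OF module_hom_Y]
  and Y_zero = module_hom.zero [OF module_hom_Y]

text \<open>The coefficient of \<open>x0^(-l-1) x1^(-m-1) x2^(-n-1)\<close> in the Jacobi identity.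
  On the right, \<open>binom_sign (int i - m - 1) i\<close> is \<open>m\<close> choose
  \<open>i\<close> with the upper index negated.\<close>

theorem borcherds_identity:
  assumes vw: "\<And>b. b \<ge> K \<Longrightarrow> Y v (n + int b) w = 0"
    and uw: "\<And>b. b \<ge> K \<Longrightarrow> Y u (m + int b) w = 0"
    and uv: "\<And>i. i \<ge> K \<Longrightarrow> Y u (l + int i) v = 0"
  shows "(\<Sum>b<K. scale (binom_sign l b) (Y u (m + l - int b) (Y v (n + int b) w))) -
      (\<Sum>b<K. scale ((- 1) powi l * binom_sign l b) (Y v (n + l - int b) (Y u (m + int b) w))) =
      (\<Sum>i<K. scale (binom_sign (int i - m - 1) i) (Y (Y u (l + int i) v) (m + n - int i) w))"
proof -
  define e where "e = (- l - 1, - m - 1, - n - 1)"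
  define F1 F2 F3 where
    "F1 = (\<lambda>(i, j, k). if i = (0::int) then Y u (- j - 1) (Y v (- k - 1) w) else 0)" and
    "F2 = (\<lambda>(i, j, k). if i = (0::int) then Y v (- k - 1) (Y u (- j - 1) w) else 0)" and
    "F3 = (\<lambda>(i, j, k). if j = (0::int) then Y (Y u (- i - 1) v) (- k - 1) w else 0)"
  \<comment> \<open>The exponents of the delta factors that can contribute: \<open>e\<close> forces
    the \<open>x0\<close>-exponent (for \<open>h3\<close> the \<open>x1\<close>-exponent), and
    homogeneity leaves one free natural number \<open>b\<close>.\<close>
  define h1 h2 h3 where
    "h1 = (\<lambda>b. (- l - 1, l - int b, int b))" and
    "h2 = (\<lambda>b. (- l - 1, int b, l - int b))" and
    "h3 = (\<lambda>b. (int b, - m - 1, m - int b))"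
  have 1: "fdist_mult scale delta_12_0 F1 e = (\<Sum>b<K. scale (delta_12_0 (h1 b)) (F1 (e - h1 b)))"
  proof (rule fdist_mult_eq_sum)
    fix d assume d: "d \<notin> h1 ` {..<K}"
    obtain i j k where [simp]: "d = (i, j, k)" by (cases d)
    show "scale (delta_12_0 d) (F1 (e - d)) = 0"
    proof (cases "i = - l - 1 \<and> k \<ge> 0 \<and> j + k = - i - 1")
      case True
      then have "d = h1 (nat k)" by (simp add: h1_def)
      with d have "nat k \<ge> K" by (meson imageI lessThan_iff not_le)
      from vw [OF this] True have "Y v (- (- n - 1 - k) - 1) w = 0" by (simp add: algebra_simps)
      then show ?thesis by (simp add: F1_def e_def Y_zero)
    qed (auto simp: F1_def e_def delta_12_0_def diff_power_coeff_def)
  qed (auto simp: h1_def inj_on_def)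
  have 2: "fdist_mult scale delta_21_0 F2 e = (\<Sum>b<K. scale (delta_21_0 (h2 b)) (F2 (e - h2 b)))"
  proof (rule fdist_mult_eq_sum)
    fix d assume d: "d \<notin> h2 ` {..<K}"
    obtain i j k where [simp]: "d = (i, j, k)" by (cases d)
    show "scale (delta_21_0 d) (F2 (e - d)) = 0"
    proof (cases "i = - l - 1 \<and> j \<ge> 0 \<and> j + k = - i - 1")
      case True
      then have "d = h2 (nat j)" by (simp add: h2_def)
      with d have "nat j \<ge> K" by (meson imageI lessThan_iff not_le)
      from uw [OF this] True have "Y u (- (- m - 1 - j) - 1) w = 0" by (simp add: algebra_simps)
      then show ?thesis by (simp add: F2_def e_def Y_zero)
    qed (auto simp: F2_def e_def delta_21_0_def diff_power_coeff_def)
  qed (auto simp: h2_def inj_on_def)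
  have 3: "fdist_mult scale delta_10_2 F3 e = (\<Sum>b<K. scale (delta_10_2 (h3 b)) (F3 (e - h3 b)))"
  proof (rule fdist_mult_eq_sum)
    fix d assume d: "d \<notin> h3 ` {..<K}"
    obtain i j k where [simp]: "d = (i, j, k)" by (cases d)
    show "scale (delta_10_2 d) (F3 (e - d)) = 0"
    proof (cases "j = - m - 1 \<and> i \<ge> 0 \<and> j + i = - k - 1")
      case True
      then have "d = h3 (nat i)" by (simp add: h3_def)
      with d have "nat i \<ge> K" by (meson imageI lessThan_iff not_le)
      from uv [OF this] True have "Y u (- (- l - 1 - i) - 1) v = 0" by (simp add: algebra_simps)
      then show ?thesis by (simp add: F3_def e_def Y_left_zero)
    qed (auto simp: F3_def e_def delta_10_2_def diff_power_coeff_def)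
  qed (auto simp: h3_def inj_on_def)
  have "fdist_mult scale delta_12_0 F1 e - fdist_mult scale delta_21_0 F2 e = fdist_mult scale delta_10_2 F3 e"
    unfolding F1_def F2_def F3_def by (rule jacobi)
  then show ?thesis
    unfolding 1 2 3
    by (simp add: h1_def h2_def h3_def e_def F1_def F2_def F3_def delta_12_0_def delta_21_0_def
        delta_10_2_def diff_power_coeff_def binom_sign_def algebra_simps)
qed

lemma truncation_nat:
  obtains K where "\<And>b. b \<ge> K \<Longrightarrow> Y u (n + int b) v = 0"
proof -
  obtain N where N: "\<forall>k\<ge>N. Y u k v = 0" using truncation by blast
  show thesis
    by (rule that [of "nat (N - n)"]) (use N in auto)
qed

text \<open>Borcherds' identity at \<open>l = 0\<close>: on the left only \<open>b = 0\<close>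
  contributes, on the right the hypothesis kills every term.\<close>

lemma modes_commute:
  assumes "\<And>i. i \<ge> 0 \<Longrightarrow> Y u i v = 0"
  shows "Y u m (Y v n w) = Y v n (Y u m w)"
proof -
  obtain K1 where K1: "\<And>b. b \<ge> K1 \<Longrightarrow> Y v (n + int b) w = 0" by (rule truncation_nat) blast
  obtain K2 where K2: "\<And>b. b \<ge> K2 \<Longrightarrow> Y u (m + int b) w = 0" by (rule truncation_nat) blast
  define K where "K = Suc (max K1 K2)"
  have b0: "binom_sign 0 b = (if b = 0 then 1 else 0)" for b
    by (simp add: binom_sign_def int_binom_0 int_binom_eq_0)
  have K: "{..<K} = insert 0 {1..<K}" by (auto simp: K_def)
  have "(\<Sum>b<K. scale (binom_sign 0 b) (Y u (m + 0 - int b) (Y v (n + int b) w))) -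
      (\<Sum>b<K. scale ((- 1) powi 0 * binom_sign 0 b) (Y v (n + 0 - int b) (Y u (m + int b) w))) =
      (\<Sum>i<K. scale (binom_sign (int i - m - 1) i) (Y (Y u (0 + int i) v) (m + n - int i) w))"
    by (rule borcherds_identity) (use K1 K2 assms in \<open>auto simp: K_def\<close>)
  then show ?thesis
    by (simp add: b0 K assms Y_left_zero)
qed

text \<open>Borcherds' identity at \<open>m = 0\<close>: the right side keeps only
  \<open>i = 0\<close>. The bounds are separate so that \<open>K2 = 0\<close> is available for
  \<open>w = one\<close>.\<close>

lemma iterate_formula:
  assumes "\<And>b. b \<ge> K1 \<Longrightarrow> Y v (n + int b) w = 0"
    and "\<And>b. b \<ge> K2 \<Longrightarrow> Y u (int b) w = 0"
  shows "Y (Y u l v) n w =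
    (\<Sum>b<K1. scale (binom_sign l b) (Y u (l - int b) (Y v (n + int b) w))) -
    (\<Sum>b<K2. scale ((- 1) powi l * binom_sign l b) (Y v (n + l - int b) (Y u (int b) w)))"
proof -
  obtain K3 where K3: "\<And>b. b \<ge> K3 \<Longrightarrow> Y u (l + int b) v = 0" by (rule truncation_nat) blast
  define K where "K = Suc (max K1 (max K2 K3))"
  have b0: "binom_sign (int b - 1) b = (if b = 0 then 1 else 0)" for b
    by (cases "b = 0") (simp_all add: binom_sign_def int_binom_0 int_binom_eq_0)
  have K: "{..<K} = insert 0 {1..<K}" by (auto simp: K_def)
  have *: "(\<Sum>b<K. scale (binom_sign l b) (Y u (0 + l - int b) (Y v (n + int b) w))) -
      (\<Sum>b<K. scale ((- 1) powi l * binom_sign l b) (Y v (n + l - int b) (Y u (0 + int b) w))) =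
      (\<Sum>i<K. scale (binom_sign (int i - 0 - 1) i) (Y (Y u (l + int i) v) (0 + n - int i) w))"
    by (rule borcherds_identity) (use assms K3 in \<open>auto simp: K_def\<close>)
  have 1: "(\<Sum>b<K1. scale (binom_sign l b) (Y u (l - int b) (Y v (n + int b) w))) =
      (\<Sum>b<K. scale (binom_sign l b) (Y u (0 + l - int b) (Y v (n + int b) w)))"
    by (rule sum.mono_neutral_cong_left) (auto simp: K_def assms Y_zero)
  have 2: "(\<Sum>b<K2. scale ((- 1) powi l * binom_sign l b) (Y v (n + l - int b) (Y u (int b) w))) =
      (\<Sum>b<K. scale ((- 1) powi l * binom_sign l b) (Y v (n + l - int b) (Y u (0 + int b) w)))"
    by (rule sum.mono_neutral_cong_left) (auto simp: K_def assms Y_zero)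
  have 3: "(\<Sum>i<K. scale (binom_sign (int i - 0 - 1) i) (Y (Y u (l + int i) v) (0 + n - int i) w)) = Y (Y u l v) n w"
    by (simp add: b0 K)
  show ?thesis unfolding 1 2 * 3 ..
qed

text \<open>The divided powers of the translation operator: \<open>D\<^bsup>(k)\<^esup> v = v\<^bsub>-k-1\<^esub> 1\<close>.\<close>

definition trans_pow :: "nat \<Rightarrow> 'v \<Rightarrow> 'v" where
  "trans_pow k v = Y v (- int k - 1) one"

text \<open>The coefficient form of conjugating a mode by \<open>e^(zD)\<close>. At the vacuum the
  creation axiom empties the second sum of the iterate formula and bounds the first by
  \<open>k\<close>.\<close>

lemma trans_pow_mode:
  "trans_pow k (Y u l v) = (\<Sum>b\<le>k. scale (binom_sign l b) (Y u (l - int b) (trans_pow (k - b) v)))"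
proof -
  have "trans_pow k (Y u l v) =
    (\<Sum>b<Suc k. scale (binom_sign l b) (Y u (l - int b) (Y v (- int k - 1 + int b) one))) -
    (\<Sum>b<0. scale ((- 1) powi l * binom_sign l b) (Y v (- int k - 1 + l - int b) (Y u (int b) one)))"
    unfolding trans_pow_def by (rule iterate_formula) (auto simp: creation)
  also have "\<dots> = (\<Sum>b\<le>k. scale (binom_sign l b) (Y u (l - int b) (trans_pow (k - b) v)))"
    by (simp add: lessThan_Suc_atMost trans_pow_def of_nat_diff algebra_simps del: sum.lessThan_Suc)
  finally show ?thesis .
qed

lemma trans_pow_one: "trans_pow k one = (if k = 0 then one else 0)"
  by (simp add: trans_pow_def vacuum)

end

section \<open>The Virasoro vacuum module\<close>

lemma pm_scale_single: "pm_scale a (Poly_Mapping.single k b) = Poly_Mapping.single k (a * b)"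
  by (auto intro!: poly_mapping_eqI simp: lookup_pm_scale lookup_single when_def)

lemma pm_scale_zero: "pm_scale a 0 = 0"
  by (auto intro!: poly_mapping_eqI simp: lookup_pm_scale)

lemma pm_scale_one: "pm_scale 1 x = x"
  by (auto intro!: poly_mapping_eqI simp: lookup_pm_scale)

lemma sum_single_lookup: "(\<Sum>k\<in>Poly_Mapping.keys x. Poly_Mapping.single k (Poly_Mapping.lookup x k)) = x"
  by (rule poly_mapping_eqI) (auto simp: lookup_sum lookup_single when_def in_keys_iff)

lemma vir_bracket_single:
  "vir_bracket (Poly_Mapping.single i 1) (Poly_Mapping.single j 1) = vir_bracket_basis i j"
  by (simp add: vir_bracket_def pm_scale_one)

lemma vir_bracket_c: "vir_bracket (Poly_Mapping.single c_basis 1) x = 0"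
  by (simp add: vir_bracket_def pm_scale_zero)

locale virasoro_vacuum_module = vector_space scale
  for scale :: "'a::field \<Rightarrow> 'v::ab_group_add \<Rightarrow> 'v" +
  fixes act :: "'a vir \<Rightarrow> 'v \<Rightarrow> 'v" and one :: 'v and c :: 'a
  assumes vacuum_module: "is_virasoro_vacuum_module c scale act one"
begin

abbreviation L :: "int \<Rightarrow> 'v \<Rightarrow> 'v" where "L n \<equiv> vir_L act n"

lemma lie_module_act: "lie_module pm_scale vir_bracket UNIV scale act"
  using vacuum_module by (simp add: is_virasoro_vacuum_module_def is_induced_module_def)

lemma module_hom_act: "module_hom scale scale (act x)"
  using lie_module_act by (simp add: lie_module_def linear_iff_module_hom)

lemmas act_add_right = module_hom.add [OF module_hom_act]
  and act_diff_right = module_hom.diff [OF module_hom_act]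
  and act_scale_right = module_hom.scale [OF module_hom_act]
  and act_zero_right = module_hom.zero [OF module_hom_act]
  and act_sum_right = module_hom.sum [OF module_hom_act]

lemma act_add_left: "act (x + y) v = act x v + act y v"
  and act_scale_left: "act (pm_scale a x) v = scale a (act x v)"
  and act_bracket: "act (vir_bracket x y) v = act x (act y v) - act y (act x v)"
  using lie_module_act by (simp_all add: lie_module_def)

lemma act_zero_left: "act 0 v = 0"
  using act_add_left [of 0 0 v] by simp

lemma act_uminus_left: "act (- x) v = - act x v"
  using act_add_left [of "- x" x v] by (simp add: act_zero_left eq_neg_iff_add_eq_0)

lemma act_sum_left: "act (sum f I) v = (\<Sum>i\<in>I. act (f i) v)"
  by (induction I rule: infinite_finite_induct) (simp_all add: act_zero_left act_add_left)

lemma act_single: "act (Poly_Mapping.single k a) v = scale a (act (Poly_Mapping.single k 1) v)"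
  by (metis act_scale_left mult.right_neutral pm_scale_single)

lemma act_expand:
  "act x v = (\<Sum>k\<in>Poly_Mapping.keys x. scale (Poly_Mapping.lookup x k) (act (Poly_Mapping.single k 1) v))"
  by (subst sum_single_lookup [of x, symmetric]) (simp only: act_sum_left act_single [of _ "Poly_Mapping.lookup x _"])

text \<open>Surjectivity of \<open>induced_eval\<close> says that words applied to
  \<open>one\<close> span the module; this serves as induction principle below.\<close>

lemma vacuum_generates:
  assumes "lie_submodule scale act U" "one \<in> U"
  shows "v \<in> U"
proof -
  have U: "subspace U" "\<And>x v. v \<in> U \<Longrightarrow> act x v \<in> U"
    using assms(1) by (auto simp: lie_submodule_def)
  have "foldr act xs (scale a one) \<in> U" for xs a
    by (induction xs) (auto intro: U subspace_scale assms(2))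
  then have "induced_eval scale act (\<lambda>a. scale a one) f \<in> U" for f
    unfolding induced_eval_def by (intro subspace_sum subspace_scale U(1))
  moreover have "surj (induced_eval scale act (\<lambda>a. scale a one))"
    using vacuum_module by (simp add: is_virasoro_vacuum_module_def is_induced_module_def)
  ultimately show ?thesis by (metis surjD)
qed

lemma act_c_one: "act (Poly_Mapping.single c_basis 1) one = scale c one"
proof -
  let ?C = "Poly_Mapping.single c_basis 1 :: 'a vir"
  let ?f = "Poly_Mapping.single ([?C], 1) 1 - Poly_Mapping.single ([], c) 1
    :: (('a vir list \<times> 'a) \<Rightarrow>\<^sub>0 'a)"
  interpret pm: vector_space "pm_scale :: 'a \<Rightarrow> (vir_basis \<Rightarrow>\<^sub>0 'a) \<Rightarrow> _"
    by (rule vector_space_pm_scale)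
  interpret pm2: vector_space "pm_scale :: 'a \<Rightarrow> (('a vir list \<times> 'a) \<Rightarrow>\<^sub>0 'a) \<Rightarrow> _"
    by (rule vector_space_pm_scale)
  have C: "?C \<in> vir_ge_minus1"
    unfolding vir_ge_minus1_def by (rule pm.span_base) simp
  have "vir_char_act c ?C 1 = c"
    by (simp add: vir_char_act_def)
  with C have "?f \<in> {Poly_Mapping.single (u @ [x], w) 1 - Poly_Mapping.single (u, vir_char_act c x w) 1
      | u x w. x \<in> vir_ge_minus1}"
    by (intro CollectI exI [of _ "[]"] exI [of _ ?C] exI [of _ 1]) simp
  then have "?f \<in> induced_relations pm_scale vir_bracket vir_ge_minus1 (*) (vir_char_act c)"
    unfolding induced_relations_def by blast
  then have "?f \<in> module.span pm_scale (induced_relations pm_scale vir_bracket vir_ge_minus1 (*) (vir_char_act c))"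
    by (rule pm2.span_base)
  then have "induced_eval scale act (\<lambda>a. scale a one) ?f = 0"
    using vacuum_module unfolding is_virasoro_vacuum_module_def is_induced_module_def by blast
  moreover have "induced_eval scale act (\<lambda>a. scale a one) ?f =
      (\<Sum>k\<in>{([?C], 1), ([], c)}. scale (Poly_Mapping.lookup ?f k) (foldr act (fst k) (scale (snd k) one)))"
    unfolding induced_eval_def
    by (rule sum.mono_neutral_left) (auto simp: in_keys_iff lookup_minus lookup_single when_def split: if_splits)
  ultimately show ?thesis
    by (simp add: lookup_minus lookup_single when_def scale_minus_left)
qed

text \<open>The central element commutes with the action, so its \<open>c\<close>-eigenspace is a
  submodule, and it contains \<open>one\<close>.\<close>

lemma act_c: "act (Poly_Mapping.single c_basis 1) v = scale c v"
proof -
  let ?C = "Poly_Mapping.single c_basis 1 :: 'a vir"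
  have "lie_submodule scale act {v. act ?C v = scale c v}"
  proof -
    have "act ?C (act x v) = act x (act ?C v)" for x v
      using act_bracket [of ?C x v] by (simp add: vir_bracket_c act_zero_left)
    then show ?thesis
      by (auto simp: lie_submodule_def subspace_def act_add_right act_scale_right act_zero_right
          scale_right_distrib scale_left_commute)
  qed
  then show ?thesis
    using vacuum_generates act_c_one by blast
qed

lemma lie_submoduleI:
  assumes "subspace U" "\<And>n v. v \<in> U \<Longrightarrow> L n v \<in> U"
  shows "lie_submodule scale act U"
  unfolding lie_submodule_def
proof (intro conjI allI ballI assms(1))
  fix x v assume v: "v \<in> U"
  have "act (Poly_Mapping.single k 1) v \<in> U" for k
    using v assms by (cases k) (auto simp: act_c subspace_scale simp flip: vir_L_def)
  then show "act x v \<in> U"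
    by (subst act_expand) (intro subspace_sum subspace_scale assms(1))
qed

lemmas L_add = act_add_right [of "Poly_Mapping.single (L_basis n) 1" for n, folded vir_L_def]
  and L_diff = act_diff_right [of "Poly_Mapping.single (L_basis n) 1" for n, folded vir_L_def]
  and L_scale = act_scale_right [of "Poly_Mapping.single (L_basis n) 1" for n, folded vir_L_def]
  and L_zero = act_zero_right [of "Poly_Mapping.single (L_basis n) 1" for n, folded vir_L_def]
  and L_sum = act_sum_right [of "Poly_Mapping.single (L_basis n) 1" for n, folded vir_L_def]

lemma act_single_L: "act (Poly_Mapping.single (L_basis n) a) v = scale a (L n v)"
  unfolding vir_L_def by (rule act_single)

lemma L_commute:
  "L m (L n v) - L n (L m v) = scale (of_int (m - n)) (L (m + n) v) +
     (if m + n = 0 then scale (1 / 2 * of_int (int_binom (m + 1) 3) * c) v else 0)"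
proof -
  have "L m (L n v) - L n (L m v) = act (vir_bracket_basis (L_basis m) (L_basis n)) v"
    unfolding vir_L_def act_bracket [symmetric] vir_bracket_single ..
  then show ?thesis
    using act_single [of c_basis "1 / 2 * of_int (int_binom (m + 1) 3)" v]
    by (auto simp: act_add_left act_single_L act_c act_zero_left)
qed

end

section \<open>Central \<open>p\<close>-th powers\<close>

lemma of_int_power_CHAR:
  assumes "prime CHAR('a)"
  shows "of_int a ^ CHAR('a) = (of_int a :: 'a::comm_ring_1)"
proof -
  have nat: "of_nat n ^ CHAR('a) = (of_nat n :: 'a)" for n
    by (induction n) (use assms in \<open>simp_all add: freshmans_dream power_0_left\<close>)
  show ?thesis
    using assms by (cases a rule: int_cases2) (simp_all add: nat minus_power_prime_CHAR)
qed

text \<open>With \<open>N = n * p\<close>, six times the binomial is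
  \<open>(1 - N)(-N)(-1 - N)\<close>, a multiple of \<open>p^2\<close>; dividing by 6 loses at most
  one factor \<open>p\<close>, and only for \<open>p = 3\<close>. This removes the central term of
  the bracket of \<open>L_{-np}\<close> with \<open>L_{np}\<close>.\<close>

lemma prime_dvd_int_binom_3:
  assumes "prime p" "p \<ge> 3" "p dvd n"
  shows "int p dvd int_binom (1 - int (n * p)) 3"
proof -
  let ?N = "int (n * p)" and ?B = "int_binom (1 - int (n * p)) 3"
  have "?B * 6 = (1 - ?N) * (- ?N) * (- 1 - ?N)"
    using int_binom_mult_fact [of "1 - ?N" 3] by (simp add: numeral_3_eq_3 fact_numeral algebra_simps)
  moreover have "int p * int p dvd ?N"
    using assms(3) by (simp add: mult_dvd_mono)
  ultimately have *: "int p * int p dvd ?B * 6"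
    by (simp only: dvd_mult dvd_mult2 dvd_minus_iff)
  show ?thesis
  proof (cases "p = 3")
    case True
    with * have "9 dvd ?B * 6" by simp
    then have "3 dvd ?B" by presburger
    with True show ?thesis by simp
  next
    case False
    have "\<not> p dvd 6"
    proof
      assume "p dvd 6"
      then have "p dvd 2 * (3::nat)" by simp
      then show False
        using assms(1,2) False prime_dvd_mult_iff [OF assms(1), of 2 3] by (auto dest: dvd_imp_le)
    qed
    then have "\<not> int p dvd 6"
      by (metis int_dvd_int_iff of_nat_numeral)
    moreover have "int p dvd ?B * 6"
      using * by (rule dvd_mult_left)
    ultimately show ?thesis
      using assms(1) by (simp add: prime_dvd_mult_iff)
  qed
qed

text \<open>\<open>j * n\<close> runs through all residues modulo \<open>p\<close>. The solution
  locates a zero factor in a product of bracket coefficients.\<close>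

lemma prime_dvd_linear_form:
  assumes "prime p" "\<not> p dvd n"
  shows "\<exists>j<p. int p dvd int j * int n - b"
proof -
  have "coprime (int n) (int p)"
    using assms by (metis coprime_commute coprime_int_iff prime_imp_coprime)
  then obtain k where "[int n * k = 1] (mod int p)"
    using cong_solve_coprime_int by blast
  then have "[int n * k * b = b] (mod int p)"
    using cong_scalar_right [of "int n * k" 1 "int p" b] by simp
  moreover have "[(k * b) mod int p * int n = int n * k * b] (mod int p)"
    unfolding cong_def by (subst mod_mult_left_eq) (simp add: mult_ac)
  ultimately have "int p dvd (k * b) mod int p * int n - b"
    using cong_trans cong_iff_dvd_diff by blast
  moreover have "0 \<le> (k * b) mod int p" "(k * b) mod int p < int p"
    using assms(1) prime_gt_0_nat by auto
  ultimately show ?thesis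
    by (intro exI [of _ "nat ((k * b) mod int p)"]) (simp add: nat_less_iff)
qed

section \<open>The vertex algebra on the vacuum module and its central operators\<close>

locale virasoro_vertex_algebra =
  vertex_algebra scale Y one + virasoro_vacuum_module scale act one c
  for scale :: "'a::field \<Rightarrow> 'v::ab_group_add \<Rightarrow> 'v" and Y one act c +
  fixes p :: nat
  assumes prime: "prime p" and p_ge_3: "p \<ge> 3" and CHAR: "CHAR('a) = p"
    and omega: "Y (L (- 2) one) n = L (n - 1)"
begin

lemma of_nat_p: "of_nat p = (0 :: 'a)"
  using CHAR of_nat_CHAR by metis

lemma of_int_dvd: "int p dvd n \<Longrightarrow> of_int n = (0 :: 'a)"
  by (rule of_int_eq_0_if_dvd [OF of_nat_p])

lemma of_int_eq_0_iff_dvd: "of_int n = (0 :: 'a) \<longleftrightarrow> int p dvd n"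
  using of_int_eq_0_iff_char_dvd [where 'a = 'a] CHAR by simp

lemma odd_p: "odd p"
  using prime_odd_nat [OF prime] p_ge_3 by simp

lemma of_nat_p_endo: "of_nat p = (0 :: ('v \<times> 'a) additive_endo)"
proof -
  have "app_endo (of_nat n) x = (scale (of_nat n) (fst x), of_nat n * snd x)" for n and x :: "'v \<times> 'a"
    by (induction n) (simp_all add: app_endo_simps app_endo_one zero_prod_def prod_eq_iff
        scale_left_distrib algebra_simps)
  then show ?thesis
    by (intro additive_endo_eqI) (simp add: of_nat_p app_endo_simps zero_prod_def)
qed

lemma L_as_mode: "L m v = Y (L (- 2) one) (m + 1) v"
  by (simp add: omega)

lemma L_one: "m \<ge> - 1 \<Longrightarrow> L m one = 0"
  by (subst L_as_mode) (simp add: creation)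

lemma additive_act: "Modules.additive (act x)"
  by standard (rule act_add_right)

lemma additive_L: "Modules.additive (L n)"
  unfolding vir_L_def by (rule additive_act)

text \<open>In the restricted structure the \<open>p\<close>-th power of \<open>L_{-n}\<close> is
  \<open>L_{-np}\<close> if \<open>p\<close> divides \<open>n\<close> and 0 otherwise; this is the
  associative \<open>p\<close>-th power minus the restricted one.\<close>

definition central_power :: "nat \<Rightarrow> 'v \<Rightarrow> 'v" where
  "central_power n v = (L (- int n) ^^ p) v - (if p dvd n then L (- int (n * p)) v else 0)"

text \<open>The form \<open>a L_k + z\<close> is kept by commutators with a mode; \<open>z\<close>
  absorbs the central charge.\<close>

definition affine_mode :: "'a \<Rightarrow> int \<Rightarrow> 'a \<Rightarrow> ('v \<times> 'a) additive_endo" where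
  "affine_mode a k z = endo_lift (\<lambda>v. scale a (L k v) + scale z v)"

lemma app_affine_mode: "app_endo (affine_mode a k z) x = (scale a (L k (fst x)) + scale z (fst x), 0)"
  unfolding affine_mode_def
  by (rule app_endo_lift, standard) (simp add: L_add scale_right_distrib)

lemma commutator_affine_mode:
  "commutator (endo_lift (L l)) (affine_mode a k z) =
   affine_mode (a * of_int (l - k)) (l + k)
     (if l + k = 0 then a * (1 / 2 * of_int (int_binom (l + 1) 3) * c) else 0)"
proof (rule additive_endo_eqI)
  fix x :: "'v \<times> 'a"
  have "L l (L k v) = L k (L l v) + (scale (of_int (l - k)) (L (l + k) v) +
     (if l + k = 0 then scale (1 / 2 * of_int (int_binom (l + 1) 3) * c) v else 0))" for v
    using L_commute [of l k v] by (simp add: algebra_simps)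
  then show "app_endo (commutator (endo_lift (L l)) (affine_mode a k z)) x = app_endo (affine_mode (a * of_int (l - k)) (l + k)
     (if l + k = 0 then a * (1 / 2 * of_int (int_binom (l + 1) 3) * c) else 0)) x"
    by (simp add: commutator_def app_endo_simps app_affine_mode app_endo_lift [OF additive_L]
        L_add L_scale scale_right_distrib del: of_int_diff)
qed

text \<open>The scalar \<open>z\<close> can stay unspecified, as the next commutator erases
  it.\<close>

lemma funpow_commutator_mode:
  "\<exists>z. (commutator (endo_lift (L (- int n))) ^^ i) (affine_mode 1 m 0) =
     affine_mode (\<Prod>j<i. of_int (- int n - (m - int j * int n))) (m - int i * int n) z"
proof (induction i)
  case (Suc i)
  then obtain z where z: "(commutator (endo_lift (L (- int n))) ^^ i) (affine_mode 1 m 0) =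
     affine_mode (\<Prod>j<i. of_int (- int n - (m - int j * int n))) (m - int i * int n) z" ..
  have "- int n + (m - int i * int n) = m - int (Suc i) * int n"
    by (simp add: algebra_simps)
  then show ?case
    unfolding funpow.simps comp_apply z commutator_affine_mode prod.lessThan_Suc by (intro exI) (simp only:)
qed (auto intro: exI [of _ 0])

text \<open>The \<open>p\<close>-fold commutator with \<open>L_{-n}\<close> is the commutator with
  its \<open>p\<close>-th power, and each step contributes one factor of the product.\<close>

lemma commutator_power_p_mode:
  "(L (- int n) ^^ p) (L m v) - L m ((L (- int n) ^^ p) v) =
   scale (\<Prod>j<p. of_int (- int n - (m - int j * int n))) (L (m - int p * int n) v)"
proof -
  let ?E = "endo_lift (L (- int n)) :: ('v \<times> 'a) additive_endo"
  let ?coef = "\<lambda>i. \<Prod>j<i. of_int (- int n - (m - int j * int n)) :: 'a"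
  obtain z where "(commutator ?E ^^ (p - 1)) (affine_mode 1 m 0) =
      affine_mode (?coef (p - 1)) (m - int (p - 1) * int n) z"
    by (rule exE [OF funpow_commutator_mode [where n = n and m = m and i = "p - 1"]])
  moreover have p_Suc: "p = Suc (p - 1)" using p_ge_3 by simp
  have "(commutator ?E ^^ p) F = commutator ?E ((commutator ?E ^^ (p - 1)) F)" for F
    by (subst p_Suc) simp
  ultimately have *: "(commutator ?E ^^ p) (affine_mode 1 m 0) =
      commutator ?E (affine_mode (?coef (p - 1)) (m - int (p - 1) * int n) z)"
    by simp
  have coef: "?coef (p - 1) * of_int (- int n - (m - int (p - 1) * int n)) = ?coef p"
    using prod.lessThan_Suc [of "\<lambda>j. of_int (- int n - (m - int j * int n)) :: 'a" "p - 1"] by (simp only: p_Suc [symmetric])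
  have idx: "- int n + (m - int (p - 1) * int n) = m - int p * int n"
    using p_ge_3 by (simp add: of_nat_diff algebra_simps)
  \<comment> \<open>Only the last of the \<open>p\<close> commutators could leave a central term,
    and only for \<open>m = p * n\<close>. Then the factor with \<open>j = 1\<close> is
    \<open>- m\<close>, hence 0, and \<open>p \<ge> 3\<close> puts it among the first
    \<open>p - 1\<close>.\<close>
  have "?coef (p - 1) = 0" if "m - int p * int n = 0"
  proof (rule prod_zero)
    have "- int n - (m - int 1 * int n) = int p * (- int n)"
      using that by simp
    then have "of_int (- int n - (m - int 1 * int n)) = (0 :: 'a)"
      by (intro of_int_dvd) simp
    then show "\<exists>j\<in>{..<p - 1}. of_int (- int n - (m - int j * int n)) = (0 :: 'a)"
      using p_ge_3 by (intro bexI [of _ 1]) auto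
  qed simp
  then have no_center: "(if m - int p * int n = 0 then ?coef (p - 1) * k else 0) = 0" for k
    by (simp only: mult_zero_left if_cancel cong: if_cong)
  have "commutator (?E ^ p) (affine_mode 1 m 0) = affine_mode (?coef p) (m - int p * int n) 0"
    unfolding funpow_commutator_prime [OF prime of_nat_p_endo odd_p, symmetric] *
      commutator_affine_mode coef idx no_center ..
  moreover have "affine_mode 1 m 0 = endo_lift (L m)"
    by (simp add: affine_mode_def)
  ultimately have "endo_apply (commutator (?E ^ p) (endo_lift (L m))) v =
      endo_apply (affine_mode (?coef p) (m - int p * int n) 0) v"
    by simp
  moreover have "endo_apply (?E ^ p * endo_lift (L m)) v = (L (- int n) ^^ p) (L m v)"
    by (simp add: endo_apply_def app_endo_simps app_endo_lift [OF additive_L]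
        flip: endo_lift_power [OF additive_L, where ?'b = 'a])
  ultimately show ?thesis
    by (simp add: commutator_def endo_apply_simps endo_apply_lift_mult additive_L endo_lift_power)
      (simp add: endo_apply_def app_affine_mode)
qed

text \<open>If \<open>p\<close> does not divide \<open>n\<close>, one of the factors
  \<open>j * n - (n + m)\<close> vanishes. If it does, all factors equal \<open>- m\<close>, their
  product is \<open>- m\<close> by Fermat, and this matches the bracket of \<open>L_{-np}\<close>
  with \<open>L_m\<close>, whose central term vanishes modulo \<open>p\<close>.\<close>

lemma central_power_commute: "central_power n (L m v) = L m (central_power n v)"
proof (cases "p dvd n")
  case False
  then obtain j where "j < p" "int p dvd int j * int n - (int n + m)"
    using prime_dvd_linear_form [OF prime] by blast
  then have "of_int (int j * int n - (int n + m)) = (0 :: 'a)"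
    by (intro of_int_dvd)
  then have "of_int (- int n - (m - int j * int n)) = (0 :: 'a)"
    by (simp add: algebra_simps)
  then have "(\<Prod>j<p. of_int (- int n - (m - int j * int n)) :: 'a) = 0"
    using \<open>j < p\<close> by (intro prod_zero) blast+
  then show ?thesis
    using commutator_power_p_mode [of n m v] False
    by (simp only: central_power_def scale_zero_left if_False diff_0_right right_minus_eq)
next
  case True
  have fac: "of_int (- int n - (m - int j * int n)) = (of_int (- m) :: 'a)" for j
  proof -
    have "int p dvd (int j - 1) * int n" using True by simp
    then have "of_int ((int j - 1) * int n) = (0 :: 'a)" by (rule of_int_dvd)
    then show ?thesis by (simp add: algebra_simps)
  qed
  have "(\<Prod>j<p. of_int (- int n - (m - int j * int n)) :: 'a) = of_int (- m)"
    unfolding fac using of_int_power_CHAR [where 'a = 'a, of "- m"] CHAR prime by simp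
  then have 1: "(L (- int n) ^^ p) (L m v) - L m ((L (- int n) ^^ p) v) = scale (of_int (- m)) (L (m - int p * int n) v)"
    using commutator_power_p_mode [of n m v] by (simp only:)
  have "of_int (int_binom (- int (n * p) + 1) 3) = (0 :: 'a)"
    using of_int_dvd [OF prime_dvd_int_binom_3 [OF prime p_ge_3 True]] by (simp add: algebra_simps)
  moreover have "of_int (- int (n * p) - m) = (of_int (- m) :: 'a)"
    using of_nat_p by simp
  moreover have "- int (n * p) + m = m - int p * int n"
    by simp
  ultimately have 2: "L (- int (n * p)) (L m v) - L m (L (- int (n * p)) v) = scale (of_int (- m)) (L (m - int p * int n) v)"
    using L_commute [of "- int (n * p)" m v] by (simp only: mult_zero_right mult_zero_left scale_zero_left if_cancel add_0_right)
  have "a - x = b - y" if "a - b = s" "x - y = s" for a b x y s :: 'v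
  proof -
    from that have "a = s + b" "x = s + y" by (simp_all add: diff_eq_eq)
    then show ?thesis by simp
  qed
  from this [OF 1 2] show ?thesis
    using True by (simp only: central_power_def L_diff if_True)
qed

lemma L_central_power_one: "m \<ge> - 1 \<Longrightarrow> L m (central_power n one) = 0"
proof -
  assume "m \<ge> - 1"
  have "(L k ^^ i) 0 = 0" for k i
    by (induction i) (simp_all add: L_zero)
  with \<open>m \<ge> - 1\<close> show ?thesis
    by (simp flip: central_power_commute add: L_one) (simp add: central_power_def L_zero)
qed

end

section \<open>Translates of the singular vectors\<close>

context virasoro_vertex_algebra
begin

section \<open>Singular vectors that are combinations of single modes\<close>

lemma L_commute_noncentral:
  "m + n \<noteq> 0 \<Longrightarrow> L m (L n v) = L n (L m v) + scale (of_int (m - n)) (L (m + n) v)"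
  using L_commute [of m n v] by (simp add: algebra_simps)

lemma L_L_one:
  assumes "m \<ge> - 1"
  shows "\<exists>z. L m (L n one) = scale (of_int (m - n)) (L (m + n) one) + scale z one"
proof -
  have "L m (L n one) = scale (of_int (m - n)) (L (m + n) one) +
      scale (if m + n = 0 then 1 / 2 * of_int (int_binom (m + 1) 3) * c else 0) one"
    using L_commute [of m n one] L_one [OF assms] L_zero [of n] by simp
  then show ?thesis by blast
qed

lemma L_L_L_one:
  assumes "a \<ge> - 1" "m \<ge> - 1"
  shows "L a (L m (L n one)) = scale (of_int (m - n)) (L a (L (m + n) one))"
  using L_L_one [OF assms(2), of n] L_one [OF assms(1)]
  by (auto simp: L_add L_scale)

lemma L0_one: "n \<ge> - 2 \<Longrightarrow> L 0 (L n one) = (if n = - 2 then scale 2 (L (- 2) one) else 0)"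
  using L_commute_noncentral [of 0 n one] L_one [of n] L_one [of 0]
  by (auto simp: L_zero)

lemma L1_one: "n \<ge> - 3 \<Longrightarrow> L 1 (L n one) = (if n = - 3 then scale 4 (L (- 2) one) else 0)"
  using L_commute_noncentral [of 1 n one] L_one [of n] L_one [of 1] L_one [of "1 + n"]
  by (cases "n = - 1") (auto simp: L_zero)

text \<open>A Lie subalgebra whose brackets have no central term, since two such indices add up to
  at most -4. It receives the remainders of Jacobson's formula.\<close>

definition negative_modes :: "'a vir set" where
  "negative_modes = {x. Poly_Mapping.keys x \<subseteq> L_basis ` {..- 2}}"

lemma act_negative_one:
  assumes "x \<in> negative_modes"
  obtains F s where "finite F" "F \<subseteq> {..- 2 :: int}" "\<And>k. k \<in> F \<Longrightarrow> s k \<noteq> 0"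
    "\<And>v. act x v = (\<Sum>k\<in>F. scale (s k) (L k v))"
proof -
  define F where "F = {k. L_basis k \<in> Poly_Mapping.keys x}"
  have keys: "Poly_Mapping.keys x = L_basis ` F" and F: "F \<subseteq> {..- 2}"
    using assms by (auto simp: negative_modes_def F_def)
  have inj: "inj_on L_basis F" by (auto simp: inj_on_def)
  have "finite F"
    using keys inj by (metis finite_imageD finite_keys)
  moreover have "act x v = (\<Sum>k\<in>F. scale (Poly_Mapping.lookup x (L_basis k)) (L k v))" for v
    by (subst act_expand) (simp add: keys sum.reindex [OF inj] vir_L_def)
  moreover have "Poly_Mapping.lookup x (L_basis k) \<noteq> 0" if "k \<in> F" for k
    using that by (simp add: F_def in_keys_iff)
  ultimately show thesis
    using F by (intro that) auto
qed

lemma L_minus_2_one_eq_0: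
  assumes "L (- 2) one = 0"
  shows "L n v = 0"
  by (subst L_as_mode) (simp add: assms Y_left_zero)

lemma two_four_nonzero: "(2 :: 'a) \<noteq> 0" "(4 :: 'a) \<noteq> 0"
proof -
  have 2: "\<not> int p dvd 2"
    using p_ge_3 by (auto dest: zdvd_imp_le)
  then show "(2 :: 'a) \<noteq> 0"
    using of_int_eq_0_iff_dvd [of 2] by simp
  then have "(2 :: 'a) * 2 \<noteq> 0" by (metis mult_eq_0_iff)
  then show "(4 :: 'a) \<noteq> 0" by simp
qed

text \<open>The lowest mode \<open>L\<^sub>-\<^sub>N\<close> of a singular combination is detected by \<open>L\<^sub>0 L\<^bsub>N-2\<^esub>\<close>, or by
  \<open>L\<^sub>1 L\<^bsub>N-3\<^esub>\<close> in case the coefficient \<open>2N - 2\<close> vanishes in characteristic \<open>p\<close>; the outer modes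
  remove the vacuum component contributed by the central charge.\<close>

lemma singular_negative_one:
  assumes "x \<in> negative_modes" and sing: "\<And>m. m \<ge> - 1 \<Longrightarrow> L m (act x one) = 0"
  shows "act x one = 0"
proof (cases "L (- 2) one = 0")
  case True
  obtain F s where "\<And>v. act x v = (\<Sum>k\<in>F. scale (s k) (L k v))"
    using act_negative_one [OF assms(1)] by metis
  then show ?thesis
    by (simp add: L_minus_2_one_eq_0 [OF True])
next
  case False
  obtain F s where F: "finite F" "F \<subseteq> {..- 2 :: int}" "\<And>k. k \<in> F \<Longrightarrow> s k \<noteq> 0"
    and act: "\<And>v. act x v = (\<Sum>k\<in>F. scale (s k) (L k v))"
    using act_negative_one [OF assms(1)] by metis
  have "F = {}"
  proof (rule ccontr)
    assume "F \<noteq> {}"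
    define N where "N = - Min F"
    have N: "- N \<in> F" "\<And>k. k \<in> F \<Longrightarrow> - N \<le> k"
      using Min_in [OF F(1) \<open>F \<noteq> {}\<close>] Min_le [OF F(1)] by (simp_all only: N_def minus_minus)
    then have "N \<ge> 2" using F(2) by auto
    have expand: "0 = (\<Sum>k\<in>F. scale (s k * of_int (m - k)) (L a (L (m + k) one)))"
      if "a \<ge> - 1" "m \<ge> - 1" for a m
    proof -
      have "0 = L a (L m (act x one))"
        using sing [OF that(2)] L_zero by simp
      then show ?thesis
        using that by (simp add: act L_sum L_scale L_L_L_one)
    qed
    have only: "(\<Sum>k\<in>F. scale (s k * of_int (m - k)) (L a (L (m + k) one))) =
        scale (s (- N) * of_int (m + N)) (L a (L (m - N) one))"
      if "\<And>k. k > - N \<Longrightarrow> L a (L (m + k) one) = 0" for a m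
    proof -
      have "(\<Sum>k\<in>F. scale (s k * of_int (m - k)) (L a (L (m + k) one))) =
          (\<Sum>k\<in>{- N}. scale (s k * of_int (m - k)) (L a (L (m + k) one)))"
        using F(1) N that by (intro sum.mono_neutral_right) force+
      then show ?thesis by simp
    qed
    show False
    proof (cases "int p dvd 2 * N - 2")
      case False
      have "0 = scale (s (- N) * of_int (N - 2 + N)) (L 0 (L (N - 2 - N) one))"
        using expand [of 0 "N - 2"] only [of 0 "N - 2"] \<open>N \<ge> 2\<close> L0_one by simp
      then have "s (- N) * of_int (2 * N - 2) * 2 = 0"
        using \<open>L (- 2) one \<noteq> 0\<close> by (simp add: L0_one)
      then show False
        using F(3) N(1) False two_four_nonzero of_int_eq_0_iff_dvd
        by (simp del: of_int_diff of_int_mult)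
    next
      case True
      \<comment> \<open>\<open>2 * N - 2\<close> and \<open>2 * N - 3\<close> are consecutive, so
        \<open>p\<close> cannot divide both; shifting \<open>- N\<close> to -3 instead of -2 brings
        in the second one.\<close>
      have "\<not> int p dvd 2 * N - 3"
      proof
        assume "int p dvd 2 * N - 3"
        then have "int p dvd (2 * N - 2) - (2 * N - 3)"
          using True by (rule dvd_diff [rotated])
        then show False using p_ge_3 by (auto dest: zdvd_imp_le)
      qed
      have "0 = scale (s (- N) * of_int (N - 3 + N)) (L 1 (L (N - 3 - N) one))"
        using expand [of 1 "N - 3"] only [of 1 "N - 3"] \<open>N \<ge> 2\<close> L1_one by simp
      then have "s (- N) * of_int (2 * N - 3) * 4 = 0"
        using \<open>L (- 2) one \<noteq> 0\<close> by (simp add: L1_one)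
      then show False
        using F(3) N(1) \<open>\<not> int p dvd 2 * N - 3\<close> two_four_nonzero
          of_int_eq_0_iff_dvd by (simp del: of_int_diff of_int_mult)
    qed
  qed
  then show ?thesis by (simp add: act)
qed

section \<open>The Lie subalgebra of modes with index at most -2\<close>

lemma negative_modes_zero: "0 \<in> negative_modes"
  by (simp add: negative_modes_def)

lemma negative_modes_single: "n \<le> - 2 \<Longrightarrow> Poly_Mapping.single (L_basis n) a \<in> negative_modes"
  by (simp add: negative_modes_def)

lemma negative_modes_add: "x \<in> negative_modes \<Longrightarrow> y \<in> negative_modes \<Longrightarrow> x + y \<in> negative_modes"
  using keys_add [of x y] by (auto simp: negative_modes_def)

lemma negative_modes_scale: "x \<in> negative_modes \<Longrightarrow> pm_scale a x \<in> negative_modes"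
  by (auto simp: negative_modes_def in_keys_iff lookup_pm_scale subset_iff)

lemma negative_modes_uminus: "x \<in> negative_modes \<Longrightarrow> - x \<in> negative_modes"
  by (auto simp: negative_modes_def in_keys_iff subset_iff)

lemma negative_modes_sum: "(\<And>i. i \<in> I \<Longrightarrow> f i \<in> negative_modes) \<Longrightarrow> sum f I \<in> negative_modes"
  by (induction I rule: infinite_finite_induct) (auto intro: negative_modes_zero negative_modes_add)

lemma negative_modes_bracket:
  assumes "x \<in> negative_modes" "y \<in> negative_modes"
  shows "vir_bracket x y \<in> negative_modes"
  unfolding vir_bracket_def
proof (intro negative_modes_sum negative_modes_scale)
  fix i j assume "i \<in> Poly_Mapping.keys x" "j \<in> Poly_Mapping.keys y"
  with assms obtain m n where "i = L_basis m" "j = L_basis n" "m \<le> - 2" "n \<le> - 2"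
    unfolding negative_modes_def by blast
  then show "(vir_bracket_basis i j :: 'a vir) \<in> negative_modes"
    by (auto intro!: negative_modes_single simp del: of_int_diff)
qed

lemma lie_subring_negative_modes:
  "lie_subring ((\<lambda>x. endo_lift (act x) :: ('v \<times> 'a) additive_endo) ` negative_modes)"
proof -
  have eqI: "F = G" if "\<And>x. app_endo F x = app_endo G x" for F G :: "('v \<times> 'a) additive_endo"
    using that by (rule additive_endo_eqI)
  note app = app_endo_lift [OF additive_act]
  have zero: "0 = (endo_lift (act 0) :: ('v \<times> 'a) additive_endo)"
    by (rule eqI) (simp add: app_endo_simps app act_zero_left zero_prod_def)
  have add: "endo_lift (act x) + endo_lift (act y) = (endo_lift (act (x + y)) :: ('v \<times> 'a) additive_endo)" for x y
    by (rule eqI) (simp add: app_endo_simps app act_add_left)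
  have uminus: "- endo_lift (act x) = (endo_lift (act (- x)) :: ('v \<times> 'a) additive_endo)" for x
    by (rule eqI) (simp add: app_endo_simps app act_uminus_left)
  have comm: "commutator (endo_lift (act x)) (endo_lift (act y)) =
      (endo_lift (act (vir_bracket x y)) :: ('v \<times> 'a) additive_endo)" for x y
    by (rule eqI) (simp add: commutator_def app_endo_simps app act_bracket)
  show ?thesis
    by standard (auto simp: zero add uminus comm intro!: imageI negative_modes_zero negative_modes_add
        negative_modes_uminus negative_modes_bracket)
qed

text \<open>The action of \<open>L\<^sub>-\<^sub>n\<close> conjugated by \<open>e\<^bsup>zD\<^esup>\<close>, as a power series in \<open>z\<close>.\<close>

definition mode_series :: "nat \<Rightarrow> ('v \<times> 'a) additive_endo fps" where
  "mode_series n = Abs_fps (\<lambda>j. endo_lift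
     (act (Poly_Mapping.single (L_basis (- int n - int j)) (binom_sign (1 - int n) j))))"

lemma trans_pow_L:
  "trans_pow k (L (- int n) v) =
   (\<Sum>b\<le>k. scale (binom_sign (1 - int n) b) (L (- int n - int b) (trans_pow (k - b) v)))"
proof -
  have idx: "1 - int n - 1 = - int n" "1 - int n - int b - 1 = - int n - int b" for b
    by simp_all
  show ?thesis
    using trans_pow_mode [of k "L (- 2) one" "1 - int n" v] by (simp only: omega idx)
qed

lemma trans_pow_L_one:
  "trans_pow k (L (- int n) one) = scale (binom_sign (1 - int n) k) (L (- int n - int k) one)"
proof -
  have "trans_pow k (L (- int n) one) =
    (\<Sum>b\<in>{k}. scale (binom_sign (1 - int n) b) (L (- int n - int b) (trans_pow (k - b) one)))"
    unfolding trans_pow_L by (rule sum.mono_neutral_right) (auto simp: trans_pow_one L_zero)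
  then show ?thesis by (simp add: trans_pow_one)
qed

text \<open>\<open>e^(zD)\<close> fixes the vacuum, so translating \<open>L_{-n}^m one\<close>
  replaces each factor by its conjugated series.\<close>

lemma trans_pow_L_power_one:
  "trans_pow k ((L (- int n) ^^ m) one) = endo_apply ((mode_series n ^ m) $ k) one"
proof (induction m arbitrary: k)
  case 0
  then show ?case by (simp add: trans_pow_one endo_apply_simps)
next
  case (Suc m)
  then show ?case
    by (simp add: trans_pow_L fps_mult_nth endo_apply_sum mode_series_def endo_apply_lift_mult
        additive_act act_single_L atLeast0AtMost)
qed

text \<open>The modes of a singular vector commute with every \<open>L m\<close>, which then meets
  the vacuum.\<close>

lemma L_trans_pow_singular:
  assumes "\<And>m. m \<ge> - 1 \<Longrightarrow> L m u = 0" "m \<ge> - 1"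
  shows "L m (trans_pow k u) = 0"
proof -
  have "Y (L (- 2) one) (m + 1) (Y u (- int k - 1) one) = Y u (- int k - 1) (Y (L (- 2) one) (m + 1) one)"
    by (rule modes_commute) (simp add: omega assms(1))
  then show ?thesis
    by (simp add: omega trans_pow_def L_one assms(2) Y_zero)
qed

lemma scaled_L_power: "((\<lambda>v. scale a (L n v)) ^^ m) v = scale (a ^ m) ((L n ^^ m) v)"
  by (induction m) (simp_all add: L_scale)

text \<open>Both sides are singular and differ by a combination of single modes applied to
  \<open>one\<close>; \<open>singular_negative_one\<close> makes that difference 0.\<close>

theorem trans_pow_central_power:
  assumes "n \<ge> 2"
  shows "trans_pow k (central_power n one) =
    (if p dvd k then scale (binom_sign (1 - int n) (k div p) ^ p) (central_power (n + k div p) one) else 0)"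
    (is "_ = ?rhs")
proof -
  let ?b = "binom_sign (1 - int n) (k div p)"
  define T where "T = {act x one | x. x \<in> negative_modes}"
  have T_add: "v + w \<in> T" if "v \<in> T" "w \<in> T" for v w
    using that by (auto simp: T_def simp flip: act_add_left intro: negative_modes_add)
  have T_scale: "scale a v \<in> T" if "v \<in> T" for a v
    using that by (auto simp: T_def simp flip: act_scale_left intro: negative_modes_scale)
  have T_diff: "v - w \<in> T" if "v \<in> T" "w \<in> T" for v w
    using T_add [OF that(1) T_scale [OF that(2), of "- 1"]] by simp
  have T_zero: "0 \<in> T"
    unfolding T_def using negative_modes_zero act_zero_left by force
  have T_L: "L i one \<in> T" if "i \<le> - 2" for i
    unfolding T_def vir_L_def using negative_modes_single [OF that, of 1] by blast
  have idx: "int j \<le> int (j * p)" for j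
    unfolding of_nat_le_iff using p_ge_3 by (cases p) auto
  define R :: "('v \<times> 'a) additive_endo" where
    "R = (mode_series n ^ p) $ k - (if p dvd k then (mode_series n $ (k div p)) ^ p else 0)"
  have "R \<in> (\<lambda>x. endo_lift (act x)) ` negative_modes"
    unfolding R_def
    by (rule lie_subring.jacobson_fps [OF lie_subring_negative_modes prime of_nat_p_endo])
      (use assms in \<open>auto simp: mode_series_def intro!: imageI negative_modes_single\<close>)
  then have R: "endo_apply R one \<in> T"
    by (auto simp: T_def endo_apply_lift additive_act)
  have "endo_apply ((mode_series n $ (k div p)) ^ p) one = scale (?b ^ p) ((L (- int (n + k div p)) ^^ p) one)"
    unfolding mode_series_def fps_nth_Abs_fps endo_lift_power [OF additive_act]
    by (simp add: act_single_L [abs_def] scaled_L_power algebra_simps)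
  then have "trans_pow k ((L (- int n) ^^ p) one) = endo_apply R one +
      (if p dvd k then scale (?b ^ p) ((L (- int (n + k div p)) ^^ p) one) else 0)"
    unfolding trans_pow_L_power_one R_def by (simp add: endo_apply_simps)
  \<comment> \<open>The \<open>p\<close>-th powers of modes cancel. What is left is the Jacobson
    remainder and the single-mode corrections inside \<open>central_power\<close>, one from each
    side.\<close>
  then have "trans_pow k (central_power n one) - ?rhs = endo_apply R one -
      (if p dvd n then trans_pow k (L (- int (n * p)) one) else 0) +
      (if p dvd k then scale (?b ^ p) (if p dvd n + k div p then L (- int ((n + k div p) * p)) one else 0) else 0)"
    by (simp add: central_power_def trans_pow_def Y_left_diff Y_left_zero scale_right_diff_distrib
        del: of_nat_add of_nat_mult)
  also have "\<dots> \<in> T"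
  proof (intro T_add T_diff R)
    show "(if p dvd n then trans_pow k (L (- int (n * p)) one) else 0) \<in> T"
    proof -
      have "- int (n * p) - int k \<le> - 2"
        using assms idx [of n] by linarith
      then show ?thesis
        unfolding trans_pow_L_one by (auto intro: T_scale T_L T_zero)
    qed
    show "(if p dvd k then scale (?b ^ p) (if p dvd n + k div p then L (- int ((n + k div p) * p)) one else 0) else 0) \<in> T"
    proof -
      have "- int ((n + k div p) * p) \<le> - 2"
        using assms idx [of "n + k div p"] by linarith
      then show ?thesis
        by (simp only: T_scale T_L T_zero scale_zero_right if_True if_False split: if_split) simp
    qed
  qed
  finally obtain x where x: "x \<in> negative_modes" and eq: "trans_pow k (central_power n one) - ?rhs = act x one"
    unfolding T_def by blast
  have "L m (act x one) = 0" if "m \<ge> - 1" for m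
    unfolding eq [symmetric] using that
    by (simp add: L_diff L_trans_pow_singular L_central_power_one L_scale L_zero)
  then show ?thesis
    using singular_negative_one [OF x] eq by simp
qed

text \<open>By the iterate formula, a mode of \<open>L m v\<close> is a finite combination of
  products of one mode of \<open>v\<close> and one \<open>L j\<close>, in either order.\<close>

lemma mode_L_mem:
  assumes "subspace U" "\<And>j l. L j (Y v l w) \<in> U" "\<And>j l. Y v l (L j w) \<in> U"
  shows "Y (L m v) n w \<in> U"
proof -
  obtain K1 where K1: "\<And>b. b \<ge> K1 \<Longrightarrow> Y v (n + int b) w = 0" by (rule truncation_nat) blast
  obtain K2 where K2: "\<And>b. b \<ge> K2 \<Longrightarrow> Y (L (- 2) one) (0 + int b) w = 0" by (rule truncation_nat) blast
  have "Y (Y (L (- 2) one) (m + 1) v) n w \<in> U"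
    by (subst iterate_formula [OF K1 K2 [unfolded add_0]])
      (auto intro!: subspace_diff subspace_sum subspace_scale assms simp: omega)
  then show ?thesis by (simp add: omega)
qed

end

section \<open>The ideal \<open>I\<^sub>\<mu>\<close>\<close>

context virasoro_vertex_algebra
begin

definition singular_generator :: "'a \<Rightarrow> nat \<Rightarrow> 'v" where
  "singular_generator \<mu> n = central_power n one - (if n = 2 then scale (\<mu> ^ p) one else 0)"

lemma I_mu_eq: "I_mu scale act one p \<mu> = lie_submodule scale act hull (singular_generator \<mu> ` {2..})"
  unfolding I_mu_def singular_generator_def central_power_def
  by (rule arg_cong [where f = "(hull) (lie_submodule scale act)"]) (simp only: image_def Bex_def atLeast_iff, blast)

lemma lie_submodule_hull: "lie_submodule scale act (lie_submodule scale act hull S)"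
proof (rule hull_in)
  fix T assume T: "Ball T (lie_submodule scale act)"
  then have "subspace (\<Inter>T)"
    by (intro subspace_Inter) (simp add: lie_submodule_def)
  with T show "lie_submodule scale act (\<Inter>T)"
    unfolding lie_submodule_def by blast
qed

lemma va_ideal_hull: "va_ideal scale Y (va_ideal scale Y hull S)"
proof (rule hull_in)
  fix T assume T: "Ball T (va_ideal scale Y)"
  then have "subspace (\<Inter>T)"
    by (intro subspace_Inter) (simp add: va_ideal_def)
  with T show "va_ideal scale Y (\<Inter>T)"
    unfolding va_ideal_def by blast
qed

lemma L_singular_generator: "m \<ge> - 1 \<Longrightarrow> L m (singular_generator \<mu> n) = 0"
  by (simp add: singular_generator_def L_diff L_central_power_one L_scale L_one L_zero)

text \<open>\<open>\<mu>\<close> enters only through a multiple of the vacuum, which positive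
  translation annihilates.\<close>

lemma trans_pow_singular_generator:
  "k > 0 \<Longrightarrow> trans_pow k (singular_generator \<mu> n) = trans_pow k (central_power n one)"
  using trans_pow_one [of k]
  by (simp add: singular_generator_def trans_pow_def Y_left_diff Y_left_scale Y_left_zero)

text \<open>The vectors whose modes all preserve \<open>U\<close> form a submodule, and it contains
  \<open>one\<close>.\<close>

lemma submodule_mode_closed:
  assumes U: "lie_submodule scale act U" and "w \<in> U"
  shows "Y v n w \<in> U"
proof -
  have sub: "subspace U" and L: "\<And>m w. w \<in> U \<Longrightarrow> L m w \<in> U"
    using U by (auto simp: lie_submodule_def vir_L_def)
  have "lie_submodule scale act {v. \<forall>n. \<forall>w\<in>U. Y v n w \<in> U}"
  proof (rule lie_submoduleI)
    show "subspace {v. \<forall>n. \<forall>w\<in>U. Y v n w \<in> U}"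
      using sub by (simp add: subspace_def Y_left_add Y_left_scale Y_left_zero)
    show "L m v \<in> {v. \<forall>n. \<forall>w\<in>U. Y v n w \<in> U}" if "v \<in> {v. \<forall>n. \<forall>w\<in>U. Y v n w \<in> U}" for m v
      using that by (simp add: mode_L_mem [OF sub] L)
  qed
  moreover have "one \<in> {v. \<forall>n. \<forall>w\<in>U. Y v n w \<in> U}"
    using subspace_0 [OF sub] by (simp add: vacuum)
  ultimately show ?thesis
    using vacuum_generates assms(2) by blast
qed

text \<open>Modes of arbitrary vectors preserve every submodule, and the vectors whose own modes map
  into the hull form a submodule, so only generators need testing.\<close>

lemma submodule_ideal:
  assumes S: "\<And>g n v. g \<in> S \<Longrightarrow> Y g n v \<in> lie_submodule scale act hull S"
  shows "va_ideal scale Y (lie_submodule scale act hull S)"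
proof -
  let ?U = "lie_submodule scale act hull S"
  have U: "lie_submodule scale act ?U" by (rule lie_submodule_hull)
  then have sub: "subspace ?U" and L: "\<And>m w. w \<in> ?U \<Longrightarrow> L m w \<in> ?U"
    by (auto simp: lie_submodule_def vir_L_def)
  have "lie_submodule scale act {w. \<forall>n v. Y w n v \<in> ?U}"
  proof (rule lie_submoduleI)
    show "subspace {w. \<forall>n v. Y w n v \<in> ?U}"
      using sub by (simp add: subspace_def Y_left_add Y_left_scale Y_left_zero)
    show "L m v \<in> {w. \<forall>n v. Y w n v \<in> ?U}" if "v \<in> {w. \<forall>n v. Y w n v \<in> ?U}" for m v
      using that by (simp add: mode_L_mem [OF sub] L)
  qed
  moreover have "S \<subseteq> {w. \<forall>n v. Y w n v \<in> ?U}"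
    using S by blast
  ultimately have "?U \<subseteq> {w. \<forall>n v. Y w n v \<in> ?U}"
    by (rule hull_minimal [rotated])
  then show ?thesis
    using sub submodule_mode_closed [OF U] by (auto simp: va_ideal_def)
qed

text \<open>The modes of a singular generator commute with all \<open>L m\<close>, so their values
  on \<open>one\<close> decide; for positive translation these are 0 or multiples of other
  generators.\<close>

lemma singular_generator_mode_mem:
  assumes "n \<ge> 2"
  shows "Y (singular_generator \<mu> n) j v \<in> I_mu scale act one p \<mu>"
proof -
  let ?g = "singular_generator \<mu> n" and ?I = "I_mu scale act one p \<mu>"
  have I: "lie_submodule scale act ?I"
    unfolding I_mu_eq by (rule lie_submodule_hull)
  then have sub: "subspace ?I" and L: "\<And>m w. w \<in> ?I \<Longrightarrow> L m w \<in> ?I"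
    by (auto simp: lie_submodule_def vir_L_def)
  have gen: "singular_generator \<mu> i \<in> ?I" if "i \<ge> 2" for i
    unfolding I_mu_eq using that by (intro hull_inc) simp
  have comm: "Y ?g j (L m v) = L m (Y ?g j v)" for m j v
  proof -
    have "Y (L (- 2) one) (m + 1) (Y ?g j v) = Y ?g j (Y (L (- 2) one) (m + 1) v)"
      by (rule modes_commute) (simp add: omega L_singular_generator)
    then show ?thesis by (simp add: omega)
  qed
  have "lie_submodule scale act {v. \<forall>j. Y ?g j v \<in> ?I}"
  proof (rule lie_submoduleI)
    show "subspace {v. \<forall>j. Y ?g j v \<in> ?I}"
      using sub by (simp add: subspace_def Y_add Y_scale Y_zero)
    show "L m v \<in> {v. \<forall>j. Y ?g j v \<in> ?I}" if "v \<in> {v. \<forall>j. Y ?g j v \<in> ?I}" for m v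
      using that by (simp add: comm L)
  qed
  moreover have "Y ?g j one \<in> ?I" for j
  proof (cases "j \<ge> 0")
    case True
    then show ?thesis by (simp add: creation subspace_0 [OF sub])
  next
    case False
    define k where "k = nat (- j - 1)"
    have trans: "Y ?g j one = trans_pow k ?g"
      using False by (simp add: trans_pow_def k_def)
    show ?thesis
    proof (cases "k = 0")
      case True
      then show ?thesis
        unfolding trans using gen [OF assms] by (simp add: trans_pow_def creation_const)
    next
      case False
      have "central_power (n + k div p) one \<in> ?I" if "p dvd k"
      proof -
        \<comment> \<open>As \<open>k > 0\<close>, the translated index exceeds 2, so the term with
          \<open>\<mu>\<close> is absent and the vector is itself a generator.\<close>
        have "n + k div p > 2"
          using False that assms by (auto elim: dvdE)
        then show ?thesis
          using gen [of "n + k div p"] by (simp add: singular_generator_def)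
      qed
      then show ?thesis
        unfolding trans using False assms
        by (simp add: trans_pow_singular_generator trans_pow_central_power subspace_0 [OF sub]
            subspace_scale [OF sub])
    qed
  qed
  ultimately show ?thesis
    using vacuum_generates [of "{v. \<forall>j. Y ?g j v \<in> ?I}" v] by blast
qed

theorem I_mu_ideal: "va_ideal scale Y (I_mu scale act one p \<mu>)"
  unfolding I_mu_eq
  by (rule submodule_ideal)
    (auto intro: singular_generator_mode_mem simp flip: I_mu_eq)

text \<open>An ideal is a submodule because each \<open>L m\<close> is a mode of
  \<open>L (- 2) one\<close>; the remaining generators are translates of the one of index 2.\<close>

theorem I_mu_eq_ideal_hull:
  "I_mu scale act one p \<mu> = va_ideal scale Y hull {singular_generator \<mu> 2}"
    (is "?I = ?J")
proof
  have J: "va_ideal scale Y ?J" by (rule va_ideal_hull)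
  then have sub: "subspace ?J" and mem: "\<And>v n w. w \<in> ?J \<Longrightarrow> Y v n w \<in> ?J" "\<And>v n w. w \<in> ?J \<Longrightarrow> Y w n v \<in> ?J"
    by (auto simp: va_ideal_def)
  have g2: "singular_generator \<mu> 2 \<in> ?J" by (rule hull_inc) simp
  have "lie_submodule scale act ?J"
  proof (rule lie_submoduleI [OF sub])
    fix m v assume "v \<in> ?J"
    then show "L m v \<in> ?J"
      using mem(1) [of v "L (- 2) one" "m + 1"] by (simp add: omega)
  qed
  moreover have "singular_generator \<mu> n \<in> ?J" if "n \<ge> 2" for n
  proof (cases "n = 2")
    case False
    \<comment> \<open>The order of translation that moves index 2 to \<open>n\<close>; the
      coefficient is 1 because \<open>binom_sign (- 1)\<close> is constantly 1.\<close>
    define k where "k = p * (n - 2)"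
    have k: "k > 0" "p dvd k" "2 + k div p = n" "k div p = n - 2"
      using that False p_ge_3 by (auto simp: k_def)
    have "trans_pow k (singular_generator \<mu> 2) = central_power n one"
      using k by (simp add: trans_pow_singular_generator trans_pow_central_power binom_sign_def
          int_binom_minus_1 flip: power_mult_distrib)
    then show ?thesis
      using mem(2) [OF g2, of "- int k - 1" one] False by (simp add: trans_pow_def singular_generator_def)
  qed (use g2 in simp)
  ultimately show "?I \<subseteq> ?J"
    unfolding I_mu_eq by (intro hull_minimal) auto
  have "singular_generator \<mu> 2 \<in> ?I"
    unfolding I_mu_eq by (intro hull_inc) simp
  then show "?J \<subseteq> ?I"
    by (intro hull_minimal I_mu_ideal) simp
qed

lemma singular_generator_2:
  "singular_generator \<mu> 2 = (L (- 2) ^^ p) one - scale (\<mu> ^ p) one"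
proof -
  have "\<not> p dvd 2"
    using p_ge_3 by (auto dest: dvd_imp_le)
  then show ?thesis
    by (simp add: singular_generator_def central_power_def)
qed

end

theorem proposition3p14:
  fixes scale :: "'a::alg_closed_field \<Rightarrow> 'v::ab_group_add \<Rightarrow> 'v"
    and act :: "'a vir \<Rightarrow> 'v \<Rightarrow> 'v"
    and Y :: "'v \<Rightarrow> int \<Rightarrow> 'v \<Rightarrow> 'v"
    and one :: 'v
    and p :: nat
    and c \<mu> :: 'a
  assumes "prime p" and "p \<ge> 3" and "CHAR('a) = p"
    and "is_virasoro_vacuum_module c scale act one"
    and "vertex_algebra scale Y one"
    and "\<forall>n. Y (vir_L act (-2) one) n = vir_L act (n - 1)"
  shows "va_ideal scale Y (I_mu scale act one p \<mu>) \<and>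
         I_mu scale act one p \<mu> =
           va_ideal scale Y hull {(vir_L act (-2) ^^ p) one - scale (\<mu> ^ p) one}"
proof -
  interpret vertex_algebra scale Y one by fact
  interpret virasoro_vertex_algebra scale Y one act c p
    by unfold_locales (rule assms assms(6) [rule_format])+
  show ?thesis
    using I_mu_ideal I_mu_eq_ideal_hull by (simp add: singular_generator_2)
qed

end
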